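(* $\mathrm{CRS}^e(\hat{\mathcal{A}})$ is closed in $\mathrm{CRS}(\hat{\mathcal{A}})$ (that is, $\mathrm{CRS}(\hat{\mathcal{A}})$ is a Bauer simplex).
   Context: $\mathcal{A}=\bigoplus_{\mathbb{N}}\mathbb{Z}$, and $\hat{\mathcal{A}}=\mathrm{Hom}(\mathcal{A},\mathbb{R}/\mathbb{Z})\cong(\mathbb{R}/\mathbb{Z})^{\mathbb{N}}$ is its Pontryagin dual, the infinite-dimensional torus with the product topology. For a locally compact second countable group $G$, $\mathrm{Sub}(G)$ is the compact metrizable space of closed subgroups of $G$ with the Chabauty topology ($H_i\to H$ iff limits of convergent sequences $g_j\in H_{i_j}$ along subsequences lie in $H$, and every $g\in H$ is a limit of some $g_i\in H_i$). $\mathrm{Aut}(G)$ is the group of bicontinuous automorphisms of $G$, acting on $\mathrm{Sub}(G)$ by $(\phi,H)\mapsto\phi(H)$. $\mathrm{CRS}(G)$ is the set of $\mathrm{Aut}(G)$-invariant Borel probability measures on $\mathrm{Sub}(G)$, with the weak* topology; it is a Choquet simplex, and $\mathrm{CRS}^e(G)$ is its set of extreme points. A Choquet simplex is called a Bauer simplex if its set of extreme points is closed. *)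

theory Defs
  imports
    "HOL-Probability.Probability"
    "HOL-Library.Function_Algebras"
    "HOL-Library.Poly_Mapping"
begin

section \<open>The circle group \<open>\<real>/\<int>\<close>\<close>

quotient_type circle = real / "\<lambda>x y. x - y \<in> \<int>"
proof (rule equivpI)
  show "reflp (\<lambda>x y::real. x - y \<in> \<int>)"
    by (auto intro!: reflpI)
  show "symp (\<lambda>x y::real. x - y \<in> \<int>)"
    by (auto intro!: sympI) (metis Ints_minus minus_diff_eq)
  show "transp (\<lambda>x y::real. x - y \<in> \<int>)"
    by (auto intro!: transpI) (metis Ints_add diff_add_cancel add_diff_eq)
qed

instantiation circle :: ab_group_add
begin

lift_definition zero_circle :: circle is "0 :: real" .

lift_definition plus_circle :: "circle \<Rightarrow> circle \<Rightarrow> circle" is "(+)"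
  by (metis Ints_add add_diff_add)

lift_definition uminus_circle :: "circle \<Rightarrow> circle" is uminus
  by (metis Ints_minus minus_diff_minus)

lift_definition minus_circle :: "circle \<Rightarrow> circle \<Rightarrow> circle" is "(-)"
proof -
  fix a b c d :: real
  assume "a - b \<in> \<int>" "c - d \<in> \<int>"
  then have "(a - b) - (c - d) \<in> \<int>" by (rule Ints_diff)
  then show "(a - c) - (b - d) \<in> \<int>" by (simp add: algebra_simps)
qed

instance
  by standard (transfer; simp)+

end

text \<open>The topology is the quotient topology. The distance is
  the distance to \<open>\<int>\<close> of a representative of the difference; it is only introduced so
  that \<^typ>\<open>circle\<close> is an instance of \<^class>\<open>metric_space\<close>.\<close>

lemma infdist_Ints_cong:
  fixes a b :: real
  assumes "a - b \<in> \<int>"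
  shows "infdist a \<int> = infdist b \<int>"
proof -
  have *: "infdist a \<int> \<le> infdist b \<int>" if "a - b \<in> \<int>" for a b :: real
  proof -
    obtain z where z: "z \<in> \<int>" "infdist b \<int> = dist b z"
      using infdist_attains_inf[of "\<int> :: real set" b] closed_Ints Ints_0 by (metis empty_iff)
    have "infdist a \<int> \<le> dist a (z + (a - b))"
      using z that by (intro infdist_le) auto
    also have "\<dots> = dist b z" by (simp add: dist_real_def)
    finally show ?thesis using z by simp
  qed
  have "b - a \<in> \<int>" using assms by (metis Ints_minus minus_diff_eq)
  then show ?thesis using *[OF assms] * by force
qed

instantiation circle :: uniformity_dist
begin

lift_definition dist_circle :: "circle \<Rightarrow> circle \<Rightarrow> real" is "\<lambda>x y. infdist (x - y) \<int>"
proof -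
  fix a b c d :: real
  assume "a - b \<in> \<int>" "c - d \<in> \<int>"
  then have "(a - b) - (c - d) \<in> \<int>" by (rule Ints_diff)
  then show "infdist (a - c) \<int> = infdist (b - d) \<int>"
    by (intro infdist_Ints_cong) (simp add: algebra_simps)
qed

definition uniformity_circle :: "(circle \<times> circle) filter"
  where "uniformity_circle = (INF e\<in>{0 <..}. principal {(x, y). dist x y < e})"

instance
  by standard (rule uniformity_circle_def)

end

instantiation circle :: metric_space
begin

definition open_circle :: "circle set \<Rightarrow> bool"
  where "open_circle U \<longleftrightarrow> open (abs_circle -` U)"

instance
proof
  show "dist x y = 0 \<longleftrightarrow> x = y" for x y :: circle
  proof (transfer)
    fix x y :: real
    show "(infdist (x - y) \<int> = 0) = (x - y \<in> \<int>)"
      using in_closed_iff_infdist_zero[of "\<int> :: real set" "x - y"] closed_Ints Ints_0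
      by (metis empty_iff)
  qed
  show "dist x y \<le> dist x z + dist y z" for x y z :: circle
  proof (transfer)
    fix x y z :: real
    obtain m where m: "m \<in> \<int>" "infdist (x - z) \<int> = dist (x - z) m"
      using infdist_attains_inf[of "\<int> :: real set" "x - z"] closed_Ints Ints_0
      by (metis empty_iff)
    obtain n where n: "n \<in> \<int>" "infdist (y - z) \<int> = dist (y - z) n"
      using infdist_attains_inf[of "\<int> :: real set" "y - z"] closed_Ints Ints_0
      by (metis empty_iff)
    have "infdist (x - y) \<int> \<le> dist (x - y) (m - n)"
      using m n by (intro infdist_le) auto
    also have "\<dots> \<le> dist (x - z) m + dist (y - z) n"
      by (simp add: dist_real_def)
    finally show "infdist (x - y) \<int> \<le> infdist (x - z) \<int> + infdist (y - z) \<int>"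
      using m n by simp
  qed
  show "open U \<longleftrightarrow> (\<forall>x\<in>U. \<forall>\<^sub>F (x', y) in uniformity. x' = x \<longrightarrow> y \<in> U)" for U :: "circle set"
  proof -
    have ev: "(\<forall>\<^sub>F (x', y) in uniformity. x' = x \<longrightarrow> y \<in> U) \<longleftrightarrow> (\<exists>e>0. \<forall>y. dist x y < e \<longrightarrow> y \<in> U)"
      for x
      by (auto simp: eventually_uniformity_metric)
    have "open (abs_circle -` U) \<longleftrightarrow> (\<forall>x\<in>U. \<exists>e>0. \<forall>y. dist x y < e \<longrightarrow> y \<in> U)"
    proof safe
      fix x assume op: "open (abs_circle -` U)" and x: "x \<in> U"
      obtain r where r: "x = abs_circle r" by (metis Quotient3_abs_rep Quotient3_circle)
      then have "r \<in> abs_circle -` U" using x by simp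
      then obtain e where e: "e > 0" "\<And>s. dist s r < e \<Longrightarrow> abs_circle s \<in> U"
        using op unfolding open_dist by auto
      have "y \<in> U" if "dist x y < e" for y
      proof -
        obtain s where s: "y = abs_circle s" by (metis Quotient3_abs_rep Quotient3_circle)
        obtain m where m: "m \<in> \<int>" "infdist (r - s) \<int> = dist (r - s) m"
          using infdist_attains_inf[of "\<int> :: real set" "r - s"] closed_Ints Ints_0
          by (metis empty_iff)
        have "dist (s + m) r < e"
          using that m unfolding r s dist_circle.abs_eq by (simp add: dist_real_def)
        then have "abs_circle (s + m) \<in> U" by (rule e)
        moreover have "abs_circle (s + m) = y"
          unfolding s using m by (simp add: circle.abs_eq_iff)
        ultimately show ?thesis by simp
      qed
      then show "\<exists>e>0. \<forall>y. dist x y < e \<longrightarrow> y \<in> U" using e(1) by blast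
    next
      assume *: "\<forall>x\<in>U. \<exists>e>0. \<forall>y. dist x y < e \<longrightarrow> y \<in> U"
      show "open (abs_circle -` U)"
        unfolding open_dist
      proof
        fix r assume "r \<in> abs_circle -` U"
        then obtain e where e: "e > 0" "\<And>y. dist (abs_circle r) y < e \<Longrightarrow> y \<in> U"
          using * by auto
        have "s \<in> abs_circle -` U" if "dist s r < e" for s
        proof -
          have "dist (abs_circle r) (abs_circle s) \<le> dist (r - s) 0"
            unfolding dist_circle.abs_eq by (intro infdist_le) auto
          also have "\<dots> < e" using that by (simp add: dist_real_def)
          finally show ?thesis using e(2) by simp
        qed
        then show "\<exists>e>0. \<forall>s. dist s r < e \<longrightarrow> s \<in> abs_circle -` U" using e(1) by blast
      qed
    qed
    then show ?thesis by (simp add: ev open_circle_def)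
  qed
qed

end

lemma dist_circle_add_le:
  fixes a b c d :: circle
  shows "dist (a + b) (c + d) \<le> dist a c + dist b d"
proof -
  have "dist (a + b) (c + d) \<le> dist (a + b) (c + b) + dist (c + b) (c + d)"
    by (rule dist_triangle)
  also have "dist (a + b) (c + b) = dist a c" by transfer simp
  also have "dist (c + b) (c + d) = dist b d" by transfer simp
  finally show ?thesis .
qed

instance circle :: topological_ab_group_add
proof
  fix a b :: circle
  have 1: "((\<lambda>x. fst x) \<longlongrightarrow> a) (nhds a \<times>\<^sub>F nhds b)" "((\<lambda>x. snd x) \<longlongrightarrow> b) (nhds a \<times>\<^sub>F nhds b)"
    by (rule filterlim_fst, rule filterlim_snd)
  then have "((\<lambda>x. dist (fst x) a + dist (snd x) b) \<longlongrightarrow> 0 + 0) (nhds a \<times>\<^sub>F nhds b)"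
    by (intro tendsto_add) (simp_all only: tendsto_dist_iff[symmetric])
  then have "((\<lambda>x. dist (fst x + snd x) (a + b)) \<longlongrightarrow> 0) (nhds a \<times>\<^sub>F nhds b)"
    by (intro Lim_null_comparison[of "\<lambda>x. dist (fst x + snd x) (a + b)"])
       (simp_all add: dist_circle_add_le)
  then show "LIM x (nhds a \<times>\<^sub>F nhds b). fst x + snd x :> nhds (a + b)"
    by (rule tendsto_dist_iff[THEN iffD2])
next
  fix a :: circle
  have *: "dist (- x) (- a) = dist x a" for x
  proof -
    have "dist (- x) (- a) = dist a x" by transfer (simp add: algebra_simps)
    then show ?thesis by (simp add: dist_commute)
  qed
  have "((\<lambda>x. x) \<longlongrightarrow> a) (nhds a)" by (rule filterlim_ident)
  then show "(uminus \<longlongrightarrow> - a) (nhds a)"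
    by (subst (asm) tendsto_dist_iff, subst tendsto_dist_iff) (simp only: *)
qed

section \<open>The infinite-dimensional torus\<close>

lemma tendsto_fun_iff:
  fixes f :: "'a \<Rightarrow> 'b \<Rightarrow> 'c::topological_space"
  shows "(f \<longlongrightarrow> l) F \<longleftrightarrow> (\<forall>i. ((\<lambda>x. f x i) \<longlongrightarrow> l i) F)"
proof -
  have "(f \<longlongrightarrow> l) F \<longleftrightarrow> limitin (product_topology (\<lambda>i. euclidean) UNIV) f l F"
    by (simp add: euclidean_product_topology)
  also have "\<dots> \<longleftrightarrow> (\<forall>i. ((\<lambda>x. f x i) \<longlongrightarrow> l i) F)"
    by (simp add: limitin_componentwise)
  finally show ?thesis .
qed

instance "fun" :: (type, topological_monoid_add) topological_monoid_add
proof
  fix a b :: "'a \<Rightarrow> 'b"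
  have 1: "(fst \<longlongrightarrow> a) (nhds a \<times>\<^sub>F nhds b)" "(snd \<longlongrightarrow> b) (nhds a \<times>\<^sub>F nhds b)"
    by (rule filterlim_fst, rule filterlim_snd)
  have "((\<lambda>x. fst x i + snd x i) \<longlongrightarrow> a i + b i) (nhds a \<times>\<^sub>F nhds b)" for i
    using 1 by (intro tendsto_add) (simp_all add: tendsto_fun_iff)
  then show "LIM x (nhds a \<times>\<^sub>F nhds b). fst x + snd x :> nhds (a + b)"
    by (simp add: tendsto_fun_iff)
qed

instance "fun" :: (type, topological_group_add) topological_group_add
proof
  fix a :: "'a \<Rightarrow> 'b"
  have "((\<lambda>x. x) \<longlongrightarrow> a) (nhds a)" by (rule filterlim_ident)
  then have "((\<lambda>x. x i) \<longlongrightarrow> a i) (nhds a)" for i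
    by (simp only: tendsto_fun_iff)
  then have "((\<lambda>x. - x i) \<longlongrightarrow> - a i) (nhds a)" for i
    by (intro tendsto_minus)
  then show "(uminus \<longlongrightarrow> - a) (nhds a)"
    by (simp add: tendsto_fun_iff)
qed

text \<open>Addition and topology on functions are the pointwise addition of
  \<^theory>\<open>HOL-Library.Function_Algebras\<close> and the product topology.\<close>

type_synonym torus = "nat \<Rightarrow> circle"

text \<open>The Pontryagin dual of the discrete group \<open>\<Oplus>\<^sub>\<nat> \<int>\<close>, with the topology of pointwise
  convergence, is isomorphic to the torus as a topological group.\<close>

definition discrete_dual :: "('a::ab_group_add \<Rightarrow> circle) set"
  where "discrete_dual = {h. \<forall>a b. h (a + b) = h a + h b}"

lemma discrete_dual_iso_torus:
  fixes ev :: "((nat \<Rightarrow>\<^sub>0 int) \<Rightarrow> circle) \<Rightarrow> torus"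
  defines "ev \<equiv> \<lambda>h i. h (frag_of i)"
  shows "ev (h + h') = ev h + ev h'"
    and "\<exists>g. homeomorphism discrete_dual UNIV ev g"
proof -
  show "ev (h + h') = ev h + ev h'"
    by (simp add: ev_def fun_eq_iff)
  define S :: "torus \<Rightarrow> (nat \<Rightarrow>\<^sub>0 int) \<Rightarrow> real"
    where "S x a = (\<Sum>i\<in>Poly_Mapping.keys a. of_int (Poly_Mapping.lookup a i) * rep_circle (x i))" for x a
  define g where "g x a = abs_circle (S x a)" for x a
  have S_eq: "S x a = (\<Sum>i\<in>K. of_int (Poly_Mapping.lookup a i) * rep_circle (x i))"
    if "finite K" "Poly_Mapping.keys a \<subseteq> K" for x a K
    unfolding S_def using that by (intro sum.mono_neutral_left) (auto simp: in_keys_iff)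
  have S_add: "S x (a + b) = S x a + S x b" for x a b
  proof -
    let ?K = "Poly_Mapping.keys a \<union> Poly_Mapping.keys b"
    have "Poly_Mapping.keys (a + b) \<subseteq> ?K" by (rule keys_add)
    then show ?thesis
      by (subst (1 2 3) S_eq[of ?K]) (auto simp: lookup_add sum.distrib algebra_simps)
  qed
  have g_add: "g x (a + b) = g x a + g x b" for x a b
    by (simp add: g_def S_add plus_circle.abs_eq)
  have g_of: "g x (frag_of i) = x i" for x i
    by (simp add: g_def S_def Quotient3_abs_rep[OF Quotient3_circle])
  have dual_diff: "h (a - b) = h a - h b" if "h \<in> discrete_dual" for h :: "(nat \<Rightarrow>\<^sub>0 int) \<Rightarrow> circle" and a b
  proof -
    have "h ((a - b) + b) = h (a - b) + h b" using that unfolding discrete_dual_def by blast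
    then show ?thesis by simp
  qed
  have dual_0: "h 0 = 0" if "h \<in> discrete_dual" for h :: "(nat \<Rightarrow>\<^sub>0 int) \<Rightarrow> circle"
    using dual_diff[OF that, of 0 0] by simp
  have g_dual: "g x \<in> discrete_dual" for x
    by (simp add: discrete_dual_def g_add)
  have g_ev: "g (ev h) = h" if h: "h \<in> discrete_dual" for h
  proof
    fix a :: "nat \<Rightarrow>\<^sub>0 int"
    have "Poly_Mapping.keys a \<subseteq> UNIV" by simp
    then show "g (ev h) a = h a"
    proof (induction a rule: frag_induction)
      case zero
      show ?case by (simp add: dual_0 g_dual h)
    next
      case (one i)
      show ?case by (simp add: g_of) (simp add: ev_def)
    next
      case (diff a b)
      then show ?case by (simp add: dual_diff g_dual h)
    qed
  qed
  have "continuous_on UNIV (\<lambda>x. g x a)" for a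
  proof -
    have "Poly_Mapping.keys a \<subseteq> UNIV" by simp
    then show ?thesis
    proof (induction a rule: frag_induction)
      case zero
      show ?case by (simp add: dual_0 g_dual)
    next
      case (one i)
      show ?case by (simp add: g_of)
    next
      case (diff a b)
      then show ?case by (simp add: dual_diff g_dual continuous_on_diff)
    qed
  qed
  then have "continuous_on UNIV g" by (rule continuous_on_coordinatewise_then_product)
  moreover have "continuous_on discrete_dual ev"
    unfolding ev_def
    by (intro continuous_on_coordinatewise_then_product
          continuous_on_subset[OF continuous_on_product_coordinates]) simp
  moreover have "ev (g x) = x" for x
    by (simp add: ev_def g_of)
  moreover have "ev ` discrete_dual = UNIV"
  proof -
    have "x \<in> ev ` discrete_dual" for x
      using g_dual[of x] calculation(3)[of x] by (metis image_eqI)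
    then show ?thesis by blast
  qed
  moreover have "g ` UNIV = discrete_dual"
  proof -
    have "h \<in> range g" if "h \<in> discrete_dual" for h
      using g_ev[OF that] by (metis rangeI)
    then show ?thesis using g_dual by blast
  qed
  ultimately show "\<exists>g. homeomorphism discrete_dual UNIV ev g"
    using g_ev by (intro exI[of _ g]) (simp add: homeomorphism_def)
qed

section \<open>Closed subgroups and the Chabauty topology\<close>

definition Aut :: "('a::topological_group_add \<Rightarrow> 'a) set"
  where "Aut = {\<phi>. bij \<phi> \<and> (\<forall>x y. \<phi> (x + y) = \<phi> x + \<phi> y) \<and>
                  continuous_on UNIV \<phi> \<and> continuous_on UNIV (inv \<phi>)}"

definition closed_subgroups :: "'a::topological_group_add set set"
  where "closed_subgroups =
    {H. closed H \<and> 0 \<in> H \<and> (\<forall>x\<in>H. \<forall>y\<in>H. x + y \<in> H) \<and> (\<forall>x\<in>H. - x \<in> H)}"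

text \<open>The hit-and-miss presentation of the topology; lemma \<open>limitin_chabauty_iff\<close> below gives the
  usual description of its convergent sequences.\<close>

definition chabauty :: "'a::topological_group_add set topology"
  where "chabauty = topology_generated_by
    ({{H \<in> closed_subgroups. H \<inter> K = {}} |K. compact K} \<union>
     {{H \<in> closed_subgroups. H \<inter> U \<noteq> {}} |U. open U})"

lemma topspace_chabauty [simp]: "topspace chabauty = closed_subgroups"
  unfolding chabauty_def topology_generated_by_topspace
proof (intro equalityI subsetI)
  fix H :: "'a set" assume "H \<in> closed_subgroups"
  then have "H \<in> {H \<in> closed_subgroups. H \<inter> {} = {}}" by simp
  then show "H \<in> \<Union>({{H \<in> closed_subgroups. H \<inter> K = {}} |K. compact K} \<union>
     {{H \<in> closed_subgroups. H \<inter> U \<noteq> {}} |U. open U})"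
    using compact_empty by blast
qed blast

lemma openin_chabauty_miss: "compact K \<Longrightarrow> openin chabauty {H \<in> closed_subgroups. H \<inter> K = {}}"
  unfolding chabauty_def by (rule topology_generated_by_Basis) blast

lemma openin_chabauty_hit: "open U \<Longrightarrow> openin chabauty {H \<in> closed_subgroups. H \<inter> U \<noteq> {}}"
  unfolding chabauty_def by (rule topology_generated_by_Basis) blast

lemma limitin_topology_generated_by:
  assumes "l \<in> \<Union>\<B>" "\<And>B. B \<in> \<B> \<Longrightarrow> l \<in> B \<Longrightarrow> \<forall>\<^sub>F x in F. f x \<in> B"
  shows "limitin (topology_generated_by \<B>) f l F"
  unfolding limitin_def topology_generated_by_topspace
proof (intro conjI allI impI)
  fix U assume U: "openin (topology_generated_by \<B>) U \<and> l \<in> U"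
  then have "generate_topology_on \<B> U" by (simp add: openin_topology_generated_by)
  then have "l \<in> U \<longrightarrow> (\<forall>\<^sub>F x in F. f x \<in> U)"
  proof induction
    case Empty
    then show ?case by simp
  next
    case (Int a b)
    then show ?case by (auto intro: eventually_conj)
  next
    case (UN K)
    show ?case
    proof
      assume "l \<in> \<Union>K"
      then obtain k where "k \<in> K" "l \<in> k" by blast
      with UN show "\<forall>\<^sub>F x in F. f x \<in> \<Union>K"
        by (blast intro: eventually_mono)
    qed
  next
    case (Basis s)
    then show ?case using assms by blast
  qed
  then show "\<forall>\<^sub>F x in F. f x \<in> U" using U by blast
qed (use assms in auto)

lemma limitin_chabauty_iff:
  fixes Hs :: "nat \<Rightarrow> 'a::{topological_group_add, t2_space, first_countable_topology} set"
  assumes lc: "locally compact (UNIV :: 'a set)"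
    and Hs: "\<And>i. Hs i \<in> closed_subgroups" and H: "H \<in> closed_subgroups"
  shows "limitin chabauty Hs H sequentially \<longleftrightarrow>
    (\<forall>r g x. strict_mono r \<longrightarrow> (\<forall>j::nat. g j \<in> Hs (r j)) \<longrightarrow> g \<longlonglongrightarrow> x \<longrightarrow> x \<in> H) \<and>
    (\<forall>x\<in>H. \<exists>g. (\<forall>i. g i \<in> Hs i) \<and> g \<longlonglongrightarrow> x)" (is "?lim \<longleftrightarrow> ?A \<and> ?B")
proof (intro iffI conjI)
  assume lim: ?lim
  have ev: "\<forall>\<^sub>F i in sequentially. Hs i \<in> U" if "openin chabauty U" "H \<in> U" for U
    using lim that unfolding limitin_def by blast
  show ?A
  proof (intro allI impI)
    fix r g x assume r: "strict_mono r" and g: "\<forall>j::nat. g j \<in> Hs (r j)" "g \<longlonglongrightarrow> x"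
    show "x \<in> H"
    proof (rule ccontr)
      assume "x \<notin> H"
      have "open (- H)" using H by (auto simp: closed_subgroups_def)
      then obtain U K where UK: "open U" "x \<in> U" "U \<subseteq> K" "K \<subseteq> - H" "compact K"
        using lc[unfolded locally_def, rule_format, of "- H" x] \<open>x \<notin> H\<close> that by auto
      have "H \<in> {H \<in> closed_subgroups. H \<inter> K = {}}"
        using UK(4) H by blast
      then have "\<forall>\<^sub>F i in sequentially. Hs i \<inter> K = {}"
        using ev[OF openin_chabauty_miss[OF UK(5)]] by (auto elim: eventually_mono)
      then have "\<forall>\<^sub>F j in sequentially. Hs (r j) \<inter> K = {}"
        using r by (rule eventually_subseq[rotated])
      moreover have "\<forall>\<^sub>F j in sequentially. g j \<in> U"
        using g(2) UK(1,2) by (auto simp: tendsto_def)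
      ultimately have "\<forall>\<^sub>F j::nat in sequentially. False"
        by eventually_elim (use g UK in blast)
      then show False by simp
    qed
  qed
  show ?B
  proof
    fix x assume x: "x \<in> H"
    obtain A :: "nat \<Rightarrow> 'a set" where A: "\<And>n. open (A n)" "\<And>n. x \<in> A n"
      "\<And>S. open S \<Longrightarrow> x \<in> S \<Longrightarrow> \<forall>\<^sub>F n in sequentially. A n \<subseteq> S"
      using countable_basis_at_decseq[of x] by metis
    have "\<exists>N. \<forall>i\<ge>N. Hs i \<inter> A n \<noteq> {}" for n
      using ev[OF openin_chabauty_hit[OF A(1)[of n]]] x H A(2)[of n]
      by (auto simp: eventually_sequentially)
    then have hit: "\<exists>N. \<forall>i\<ge>N. \<exists>y. y \<in> Hs i \<inter> S" if S: "open S" "x \<in> S" for S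
      using A(3)[OF S] unfolding eventually_sequentially by (metis disjoint_iff le_refl subsetD IntI)
    obtain D :: "nat \<Rightarrow> 'a set" where D: "\<And>n. open (D n)" "\<And>n. x \<in> D n" "decseq D"
      "\<And>S. open S \<Longrightarrow> x \<in> S \<Longrightarrow> \<forall>\<^sub>F n in sequentially. D n \<subseteq> S"
    proof -
      let ?D = "\<lambda>n. \<Inter>i\<le>n. A i"
      have "\<forall>\<^sub>F n in sequentially. ?D n \<subseteq> S" if "open S" "x \<in> S" for S
        using A(3)[OF that] by eventually_elim auto
      moreover have "decseq ?D" by (fastforce simp: decseq_def)
      moreover have "open (?D n)" for n using A(1) by (intro open_INT) auto
      moreover have "x \<in> ?D n" for n using A(2) by blast
      ultimately show ?thesis using that[of ?D] by blast
    qed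
    define P where "P i y \<longleftrightarrow> y \<in> Hs i \<and> (\<forall>n\<le>i. (\<exists>z\<in>Hs i. z \<in> D n) \<longrightarrow> y \<in> D n)" for i y
    have "\<exists>y. P i y" for i
    proof (cases "\<exists>n\<le>i. \<exists>z\<in>Hs i. z \<in> D n")
      case False
      moreover have "0 \<in> Hs i" using Hs[of i] by (simp add: closed_subgroups_def)
      ultimately have "P i 0" unfolding P_def by blast
      then show ?thesis ..
    next
      case True
      define Q where "Q n \<longleftrightarrow> n \<le> i \<and> (\<exists>z\<in>Hs i. z \<in> D n)" for n
      have "\<exists>n. Q n" using True unfolding Q_def by blast
      moreover have bound: "n \<le> i" if "Q n" for n using that unfolding Q_def by blast
      ultimately have "Q (Greatest Q)" by (metis GreatestI_ex_nat)
      then obtain y where y: "y \<in> Hs i" "y \<in> D (Greatest Q)" unfolding Q_def by blast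
      have "n \<le> Greatest Q" if "n \<le> i" "\<exists>z\<in>Hs i. z \<in> D n" for n
        using Greatest_le_nat[of Q n i] bound that unfolding Q_def by blast
      then have "D (Greatest Q) \<subseteq> D n" if "n \<le> i" "\<exists>z\<in>Hs i. z \<in> D n" for n
        using that by (intro decseqD[OF D(3)])
      then have "P i y" unfolding P_def using y by blast
      then show ?thesis by blast
    qed
    then have "P i (SOME y. P i y)" for i by (rule someI_ex)
    then obtain g where g: "\<And>i. P i (g i)" by (rule that)
    have "g \<longlonglongrightarrow> x"
    proof (rule topological_tendstoI)
      fix S assume "open S" "x \<in> S"
      then have "\<forall>\<^sub>F n in sequentially. D n \<subseteq> S" by (rule D(4))
      then obtain n where n: "D n \<subseteq> S" unfolding eventually_sequentially by blast
      obtain N where N: "\<forall>i\<ge>N. \<exists>y. y \<in> Hs i \<inter> D n" using hit[OF D(1)[of n] D(2)[of n]] ..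
      have "g i \<in> S" if "i \<ge> max n N" for i
      proof -
        have "\<exists>z\<in>Hs i. z \<in> D n" "n \<le> i" using N that by auto
        then show ?thesis using g[of i] n unfolding P_def by blast
      qed
      then show "\<forall>\<^sub>F i in sequentially. g i \<in> S" unfolding eventually_sequentially by blast
    qed
    moreover have "\<forall>i. g i \<in> Hs i" using g unfolding P_def by blast
    ultimately show "\<exists>g. (\<forall>i. g i \<in> Hs i) \<and> g \<longlonglongrightarrow> x" by blast
  qed
next
  assume AB: "?A \<and> ?B"
  show ?lim
    unfolding chabauty_def
  proof (rule limitin_topology_generated_by, goal_cases)
    case 1
    then show ?case using H topspace_chabauty[where 'a = 'a]
      unfolding chabauty_def topology_generated_by_topspace by simp
  next
    case (2 B)
    from 2(1) consider K where "compact K" "B = {H \<in> closed_subgroups. H \<inter> K = {}}"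
      | U where "open U" "B = {H \<in> closed_subgroups. H \<inter> U \<noteq> {}}" by blast
    then show ?case
    proof cases
      case K: 1
      have "\<forall>\<^sub>F i in sequentially. Hs i \<inter> K = {}"
      proof (rule ccontr)
        assume "\<not> ?thesis"
        then have "\<exists>\<^sub>F i in sequentially. Hs i \<inter> K \<noteq> {}" by (simp add: not_eventually)
        then have inf: "infinite {i. Hs i \<inter> K \<noteq> {}}"
          by (simp add: INFM_iff_infinite cofinite_eq_sequentially[symmetric])
        define r where "r = enumerate {i. Hs i \<inter> K \<noteq> {}}"
        have r: "strict_mono r"
          unfolding r_def using inf by (rule strict_mono_enumerate)
        have "r j \<in> {i. Hs i \<inter> K \<noteq> {}}" for j
          unfolding r_def using inf by (rule enumerate_in_set)
        then have "\<forall>j. \<exists>y. y \<in> Hs (r j) \<and> y \<in> K" by blast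
        from choice[OF this] obtain g where g: "\<forall>j. g j \<in> Hs (r j) \<and> g j \<in> K" ..
        have "seq_compact K" using K(1) by (rule compact_imp_seq_compact)
        then obtain x s where xs: "x \<in> K" "strict_mono s" "(g \<circ> s) \<longlonglongrightarrow> x"
          using g unfolding seq_compact_def by blast
        have "strict_mono (r \<circ> s)" using r xs(2) by (rule strict_mono_o)
        moreover have "\<forall>j. (g \<circ> s) j \<in> Hs ((r \<circ> s) j)" using g by simp
        ultimately have "x \<in> H" using AB xs(3) by blast
        then show False using 2(2) K(2) xs(1) by blast
      qed
      then show ?thesis unfolding K(2) using Hs by simp
    next
      case U: 2
      then obtain x where "x \<in> H" "x \<in> U" using 2(2) by blast
      then obtain g where g: "\<forall>i. g i \<in> Hs i" "g \<longlonglongrightarrow> x" using AB by blast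
      have "\<forall>\<^sub>F i in sequentially. g i \<in> U"
        using g(2) U(1) \<open>x \<in> U\<close> by (auto simp: tendsto_def)
      then show ?thesis
      proof eventually_elim
        case (elim i)
        then show ?case unfolding U(2) using Hs[of i] g(1) by blast
      qed
    qed
  qed
qed

lemma Aut_image_closed_subgroups:
  assumes \<phi>: "\<phi> \<in> Aut" and H: "H \<in> closed_subgroups"
  shows "\<phi> ` H \<in> closed_subgroups"
proof -
  have bij: "bij \<phi>" and add: "\<And>x y. \<phi> (x + y) = \<phi> x + \<phi> y" and inv: "continuous_on UNIV (inv \<phi>)"
    using \<phi> by (auto simp: Aut_def)
  have 0: "\<phi> 0 = 0" using add[of 0 0] by (metis add.right_neutral add_left_cancel)
  have uminus: "\<phi> (- x) = - \<phi> x" for x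
    using add[of "- x" x] 0 by (simp add: eq_neg_iff_add_eq_0)
  have "\<phi> ` H = inv \<phi> -` H" using bij_vimage_eq_inv_image[OF bij_imp_bij_inv[OF bij], of H] bij
    by (simp add: inv_inv_eq)
  then have "closed (\<phi> ` H)"
    using inv H by (simp add: closed_vimage closed_subgroups_def)
  moreover have "0 \<in> \<phi> ` H"
    using H by (intro image_eqI[where x = 0]) (simp_all add: 0 closed_subgroups_def)
  ultimately show ?thesis
    using H by (simp add: closed_subgroups_def add[symmetric] uminus[symmetric])
qed

lemma continuous_map_chabauty_Aut:
  assumes \<phi>: "\<phi> \<in> Aut"
  shows "continuous_map chabauty chabauty ((`) \<phi>)"
proof -
  have bij: "bij \<phi>" and cont: "continuous_on UNIV \<phi>" and inv: "continuous_on UNIV (inv \<phi>)"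
    using \<phi> by (auto simp: Aut_def)
  have *: "\<phi> ` H \<inter> K = {} \<longleftrightarrow> H \<inter> \<phi> -` K = {}" for H K by blast
  show ?thesis
  proof (subst (2) chabauty_def, rule continuous_on_generated_topo)
    fix W :: "'a set set"
    assume "W \<in> {{H \<in> closed_subgroups. H \<inter> K = {}} |K. compact K} \<union>
      {{H \<in> closed_subgroups. H \<inter> U \<noteq> {}} |U. open U}"
    then consider K where "compact K" "W = {H \<in> closed_subgroups. H \<inter> K = {}}"
      | U where "open U" "W = {H \<in> closed_subgroups. H \<inter> U \<noteq> {}}" by blast
    then show "openin chabauty ((`) \<phi> -` W \<inter> topspace chabauty)"
    proof cases
      case K: 1
      have "\<phi> -` K = inv \<phi> ` K"
        using bij by (simp add: bij_vimage_eq_inv_image)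
      then have "compact (\<phi> -` K)"
        using K(1) inv by (metis compact_continuous_image continuous_on_subset subset_UNIV)
      moreover have "(`) \<phi> -` W \<inter> topspace chabauty = {H \<in> closed_subgroups. H \<inter> \<phi> -` K = {}}"
        unfolding K(2) using Aut_image_closed_subgroups[OF \<phi>] * by auto
      ultimately show ?thesis by (simp only: openin_chabauty_miss)
    next
      case U: 2
      have "open (\<phi> -` U)" using U(1) cont by (rule open_vimage)
      moreover have "(`) \<phi> -` W \<inter> topspace chabauty = {H \<in> closed_subgroups. H \<inter> \<phi> -` U \<noteq> {}}"
        unfolding U(2) using Aut_image_closed_subgroups[OF \<phi>] * by auto
      ultimately show ?thesis by (simp only: openin_chabauty_hit)
    qed
  next
    show "(`) \<phi> ` topspace chabauty \<subseteq> \<Union>({{H \<in> closed_subgroups. H \<inter> K = {}} |K. compact K} \<union>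
      {{H \<in> closed_subgroups. H \<inter> U \<noteq> {}} |U. open U})"
      using Aut_image_closed_subgroups[OF \<phi>] topspace_chabauty[where 'a = 'a]
      unfolding chabauty_def topology_generated_by_topspace by auto
  qed
qed

section \<open>Borel probability measures and the weak* topology\<close>

definition borel_of_top :: "'b topology \<Rightarrow> 'b measure"
  where "borel_of_top X = sigma (topspace X) {U. openin X U}"

definition borel_probs :: "'b topology \<Rightarrow> 'b measure set"
  where "borel_probs X = {\<mu>. prob_space \<mu> \<and> sets \<mu> = sets (borel_of_top X)}"

text \<open>The coarsest topology making \<open>\<mu> \<mapsto> \<integral> f d\<mu>\<close> continuous for every continuous
  \<open>f : X \<rightarrow> \<real>\<close>. It is meant for compact \<open>X\<close>, where every such \<open>f\<close> is bounded.\<close>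

definition weak_star :: "'b topology \<Rightarrow> 'b measure topology"
  where "weak_star X = topology_generated_by
    {{\<mu> \<in> borel_probs X. (\<integral>x. f x \<partial>\<mu>) \<in> V} |f V. continuous_map X euclideanreal f \<and> open V}"

lemma topspace_weak_star [simp]: "topspace (weak_star X) = borel_probs X"
  unfolding weak_star_def topology_generated_by_topspace
proof (intro equalityI subsetI)
  fix \<mu> assume "\<mu> \<in> borel_probs X"
  then have "\<mu> \<in> {\<mu> \<in> borel_probs X. (\<integral>x. 0 \<partial>\<mu>) \<in> (UNIV :: real set)}" by simp
  moreover have "continuous_map X euclideanreal (\<lambda>_. 0)" by simp
  ultimately show "\<mu> \<in> \<Union>{{\<mu> \<in> borel_probs X. (\<integral>x. f x \<partial>\<mu>) \<in> V} |f V.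
      continuous_map X euclideanreal f \<and> open V}"
    using open_UNIV by blast
qed blast

text \<open>Measures do not form a vector space, so \<^const>\<open>extreme_point_of\<close> does not apply; this is
  its definition with the convex combination of measures written out.\<close>

definition extreme_measures :: "'b measure set \<Rightarrow> 'b measure set"
  where "extreme_measures C = {\<mu> \<in> C. \<not> (\<exists>\<nu>\<^sub>1\<in>C. \<exists>\<nu>\<^sub>2\<in>C. \<nu>\<^sub>1 \<noteq> \<nu>\<^sub>2 \<and>
    (\<exists>t. 0 < t \<and> t < 1 \<and>
      (\<forall>A\<in>sets \<mu>. measure \<mu> A = (1 - t) * measure \<nu>\<^sub>1 A + t * measure \<nu>\<^sub>2 A)))}"

section \<open>Characteristic random subgroups\<close>

lemma measurable_Aut_image:
  assumes "\<phi> \<in> Aut"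
  shows "(`) \<phi> \<in> borel_of_top chabauty \<rightarrow>\<^sub>M borel_of_top chabauty"
proof -
  have sub: "{U. openin X U} \<subseteq> Pow (topspace X)" for X :: "'a set topology"
    using openin_subset by blast
  note c = continuous_map_chabauty_Aut[OF assms]
  show ?thesis
    unfolding borel_of_top_def
  proof (rule measurable_measure_of[OF sub])
    show "(`) \<phi> \<in> space (sigma (topspace chabauty) {U. openin chabauty U}) \<rightarrow> topspace chabauty"
      using Aut_image_closed_subgroups[OF assms] by (simp add: space_measure_of[OF sub, of chabauty, simplified])
    fix W assume "W \<in> {U. openin chabauty (U :: 'a set set)}"
    then have "openin chabauty {H \<in> topspace chabauty. \<phi> ` H \<in> W}"
      using c by (simp add: continuous_map_def)
    moreover have "(`) \<phi> -` W \<inter> topspace chabauty = {H \<in> topspace chabauty. \<phi> ` H \<in> W}"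
      by auto
    ultimately show "(`) \<phi> -` W \<inter> space (sigma (topspace chabauty) {U. openin chabauty U})
        \<in> sets (sigma (topspace chabauty) {U. openin chabauty U})"
      unfolding space_measure_of[OF sub] sets_measure_of[OF sub] by auto
  qed
qed

definition CRS :: "'a::topological_group_add set measure set"
  where "CRS = {\<mu> \<in> borel_probs chabauty.
    \<forall>\<phi>\<in>Aut. distr \<mu> (borel_of_top chabauty) ((`) \<phi>) = \<mu>}"

definition CRS_topology :: "'a::topological_group_add set measure topology"
  where "CRS_topology = subtopology (weak_star chabauty) CRS"

definition CRS_extreme :: "'a::topological_group_add set measure set"
  where "CRS_extreme = extreme_measures CRS"

end

theory Submission
  imports Defs
begin

text \<open>By duality a closed subgroup of the torus is determined by the characters that are trivial
  on it. Since the circle has no small subgroups, the set of closed subgroups on which finitely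
  many given characters are trivial is clopen, and such sets generate the Borel structure.
  Invariance under permutations of the coordinates and under the automorphisms \<open>id \<times> \<phi>\<close> of
  \<open>(\<real>/\<int>)\<^sup>n \<times> (\<real>/\<int>)\<^sup>\<nat>\<close> shows that an invariant measure is extreme iff events depending
  on disjoint sets of coordinates are independent. Independence is a family of equations between
  measures of clopen sets, which is a closed condition in the weak* topology.\<close>

section \<open>Characters of the torus\<close>

text \<open>Extremality is a condition on all decompositions inside \<open>CRS\<close>, and a limit
  of extreme points need not be extreme, so it has to be replaced by equations in the measure alone.
  The obstacle is that conditioning on a cylinder may destroy invariance under automorphisms that
  move its coordinates. Pushing forward along the map that forgets those coordinates restores it.
  That map is not an automorphism, but \<open>\<mu>\<close> is still invariant under it: a cylinder
  sees only finitely many coordinates, where the shift agrees with a permutation. So a cylinder of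
  probability strictly between 0 and 1 and its complement yield a convex decomposition of
  \<open>\<mu>\<close> itself, and extremality makes its two pieces equal. Conversely, independence
  kills the fluctuation of averages over disjoint shifts, as in the weak law of large numbers; this
  second-moment estimate takes the place of an ergodic decomposition.\<close>

lift_definition circle_exp :: "circle \<Rightarrow> complex" is "\<lambda>r. cis (2 * pi * r)"
proof -
  fix r s :: real
  assume "r - s \<in> \<int>"
  then have "cis (2 * pi * (r - s)) = 1" by (rule cis_multiple_2pi)
  then show "cis (2 * pi * r) = cis (2 * pi * s)"
    by (simp add: right_diff_distrib flip: cis_divide)
qed

lemma circle_exp_add: "circle_exp (a + b) = circle_exp a * circle_exp b"
  by transfer (simp add: cis_mult distrib_left)

lemma norm_circle_exp [simp]: "norm (circle_exp a) = 1"
  by transfer simp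

lemma inj_circle_exp: "inj circle_exp"
proof (rule injI)
  fix a b :: circle
  assume "circle_exp a = circle_exp b"
  then show "a = b"
  proof transfer
    fix r s :: real
    assume "cis (2 * pi * r) = cis (2 * pi * s)"
    then have "cos (2 * pi * r - 2 * pi * s) = 1"
      by (metis cis_divide cis_neq_zero cis.sel(1) divide_self one_complex.sel(1))
    then obtain n :: int where "2 * pi * r - 2 * pi * s = of_int n * 2 * pi"
      by (auto simp: cos_one_2pi_int)
    then have "2 * pi * (r - s) = 2 * pi * of_int n" by (simp add: algebra_simps)
    then have "r - s = of_int n" by simp
    then show "r - s \<in> \<int>" by simp
  qed
qed

lemma open_circle_iff: "open U \<longleftrightarrow> open (abs_circle -` U)" for U :: "circle set"
  by (rule open_circle_def)

lemma continuous_abs_circle: "continuous_on UNIV abs_circle"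
  by (subst continuous_on_open_vimage) (auto simp: open_circle_iff)

lemma continuous_circle_exp: "continuous_on UNIV circle_exp"
proof -
  have "abs_circle -` circle_exp -` U = (\<lambda>r. cis (2 * pi * r)) -` U" for U
    by (auto simp: circle_exp.abs_eq)
  moreover have "continuous_on UNIV (\<lambda>r. cis (2 * pi * r))"
    by (intro continuous_intros)
  ultimately show ?thesis
    by (subst continuous_on_open_vimage) (auto simp: open_circle_iff intro: open_vimage)
qed

lemma compact_UNIV_circle: "compact (UNIV :: circle set)"
proof -
  have "a \<in> abs_circle ` {0..1}" for a :: circle
  proof -
    obtain r where r: "a = abs_circle r" by (metis Quotient3_abs_rep Quotient3_circle)
    have "a = abs_circle (frac r)"
      by (simp add: r circle.abs_eq_iff frac_def)
    moreover have "frac r \<in> {0..1}" using frac_lt_1[of r] by simp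
    ultimately show ?thesis by blast
  qed
  then have "UNIV = abs_circle ` {0..1}" by blast
  then show ?thesis
    using compact_continuous_image[OF continuous_on_subset[OF continuous_abs_circle], of "{0..1}"]
    by simp
qed

lemma compact_UNIV_torus: "compact (UNIV :: torus set)"
proof -
  have "compact_space (euclidean :: circle topology)"
    by (simp add: compact_space_def compact_UNIV_circle)
  then have "compact_space (product_topology (\<lambda>_::nat. euclidean :: circle topology) UNIV)"
    by (simp add: compact_space_product_topology)
  then show ?thesis
    by (simp add: euclidean_product_topology compact_space_def)
qed

lemma compact_torus_iff_closed: "compact K \<longleftrightarrow> closed K" for K :: "torus set"
  using compact_UNIV_torus by (metis closed_Int_compact compact_imp_closed inf_top_right)

text \<open>A character is given by a word in the coordinates and their inverses, \<open>(True, i)\<close> standing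
  for the \<open>i\<close>-th coordinate and \<open>(False, i)\<close> for its inverse.\<close>

definition "character" :: "(bool \<times> nat) list \<Rightarrow> torus \<Rightarrow> complex"
  where "character l x = (\<Prod>(s, i)\<leftarrow>l. if s then circle_exp (x i) else cnj (circle_exp (x i)))"

lemma character_Nil [simp]: "character [] x = 1"
  by (simp add: character_def)

lemma character_Cons:
  "character ((s, i) # l) x = (if s then circle_exp (x i) else cnj (circle_exp (x i))) * character l x"
  by (simp add: character_def)

lemma character_append: "character (l @ m) x = character l x * character m x"
  by (simp add: character_def)

lemma character_cnj: "character (map (apfst Not) l) x = cnj (character l x)"
  by (induction l) (auto simp: character_Cons split: if_splits)

lemma character_coord [simp]: "character [(True, i)] x = circle_exp (x i)"
  by (simp add: character_def)

lemma character_add: "character l (x + y) = character l x * character l y"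
  by (induction l) (auto simp: character_Cons circle_exp_add split: if_splits)

lemma norm_character [simp]: "norm (character l x) = 1"
  by (induction l) (auto simp: character_Cons norm_mult)

lemma character_zero [simp]: "character l 0 = 1"
proof -
  have "character l 0 = character l 0 * character l 0"
    using character_add[of l 0 0] by (simp only: add_0_right)
  moreover have "character l 0 \<noteq> 0" using norm_character[of l 0] by (metis norm_zero zero_neq_one)
  ultimately show ?thesis by (metis mult_cancel_left2)
qed

lemma character_reindex: "character l (\<lambda>i. x (f i)) = character (map (apsnd f) l) x"
  by (induction l) (auto simp: character_Cons)

lemma character_cong:
  assumes "\<And>i. i \<in> snd ` set l \<Longrightarrow> x i = y i"
  shows "character l x = character l y"
  using assms by (induction l) (auto simp: character_Cons split: if_splits)

lemma continuous_on_torus_coordinate: "continuous_on A (\<lambda>x::torus. x i)"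
  by (rule continuous_on_subset[OF continuous_on_product_coordinates subset_UNIV])

lemma continuous_character: "continuous_on A (character l)"
proof (induction l)
  case Nil
  then show ?case by simp
next
  case (Cons p l)
  obtain s i where p: "p = (s, i)" by fastforce
  have e: "continuous_on A (\<lambda>x. circle_exp (x i))"
    by (rule continuous_on_compose2[OF continuous_circle_exp continuous_on_torus_coordinate]) simp
  have "character (p # l) = (\<lambda>x. (if s then circle_exp (x i) else cnj (circle_exp (x i))) * character l x)"
    by (auto simp: p character_def)
  then show ?case
    using Cons e by (cases s) (auto intro!: continuous_intros)
qed

section \<open>Duality for closed subgroups\<close>

text \<open>Kept as a list of terms so that averaging can discard terms by \<open>filter\<close> and
  \<open>trig_poly_bounds_glue\<close> can induct on the length. Taking real parts makes the real
  Stone-Weierstrass theorem applicable.\<close>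

definition trig_poly :: "(complex \<times> (bool \<times> nat) list) list \<Rightarrow> torus \<Rightarrow> real"
  where "trig_poly L x = (\<Sum>(c, l)\<leftarrow>L. Re (c * character l x))"

lemma trig_poly_Nil [simp]: "trig_poly [] x = 0"
  and trig_poly_Cons: "trig_poly ((c, l) # L) x = Re (c * character l x) + trig_poly L x"
  by (simp_all add: trig_poly_def)

lemma trig_poly_append: "trig_poly (L @ M) x = trig_poly L x + trig_poly M x"
  by (simp add: trig_poly_def)

text \<open>The identity Re u * Re v = Re (u v / 2) + Re (u cnj v / 2) turns a product of two terms
  into two terms; the second one uses the conjugate word \<open>map (apfst Not) m\<close>.\<close>

lemma trig_poly_mult: "\<exists>N. \<forall>x. trig_poly N x = trig_poly L x * trig_poly M x"
proof (induction L)
  case Nil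
  show ?case by (intro exI[of _ "[]"]) simp
next
  case (Cons p L)
  obtain c l where p: "p = (c, l)" by fastforce
  have "\<exists>N. \<forall>x. trig_poly N x = Re (c * character l x) * trig_poly M x"
  proof (induction M)
    case Nil
    show ?case by (intro exI[of _ "[]"]) simp
  next
    case (Cons q M)
    obtain d m where q: "q = (d, m)" by fastforce
    from Cons obtain N where N: "\<forall>x. trig_poly N x = Re (c * character l x) * trig_poly M x" ..
    have 1: "Re u * Re v = Re (u * v / 2) + Re (u * cnj v / 2)" for u v
      by (simp add: field_simps)
    have "Re (c * character l x) * Re (d * character m x)
      = Re ((c * d / 2) * character (l @ m) x) + Re ((c * cnj d / 2) * character (l @ map (apfst Not) m) x)" for x
      unfolding 1 character_append character_cnj by (simp only: complex_cnj_mult mult_ac times_divide_eq_right times_divide_eq_left)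
    then have "\<forall>x. trig_poly ((c * d / 2, l @ m) # (c * cnj d / 2, l @ map (apfst Not) m) # N) x
      = Re (c * character l x) * trig_poly (q # M) x"
      using N by (simp only: trig_poly_Cons q distrib_left) (simp only: add.assoc simp_thms)
    then show ?case by blast
  qed
  then obtain N1 where N1: "\<forall>x. trig_poly N1 x = Re (c * character l x) * trig_poly M x" ..
  from Cons obtain N2 where N2: "\<forall>x. trig_poly N2 x = trig_poly L x * trig_poly M x" ..
  have "\<forall>x. trig_poly (N1 @ N2) x = trig_poly (p # L) x * trig_poly M x"
    using N1 N2 by (simp only: trig_poly_append p trig_poly_Cons distrib_right) simp
  then show ?case by blast
qed

lemma trig_poly_dense:
  assumes f: "continuous_on UNIV f" and "\<epsilon> > 0"
  shows "\<exists>L. \<forall>x. \<bar>f x - trig_poly L x\<bar> < \<epsilon>"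
proof -
  interpret function_ring_on "range trig_poly" UNIV
  proof
    fix f assume "f \<in> range trig_poly"
    then obtain L where f: "f = trig_poly L" by blast
    have "continuous_on UNIV (trig_poly L)"
      unfolding trig_poly_def
    proof (induction L)
      case (Cons a L)
      then show ?case
        by (auto simp: case_prod_beta intro!: continuous_intros continuous_character)
    qed simp
    then show "continuous_on UNIV f" unfolding f .
    fix g assume "g \<in> range trig_poly"
    then obtain M where g: "g = trig_poly M" by blast
    have "(\<lambda>x. f x + g x) = trig_poly (L @ M)" by (auto simp: f g trig_poly_append)
    then show "(\<lambda>x. f x + g x) \<in> range trig_poly" by blast
    obtain N where "\<forall>x. trig_poly N x = f x * g x" using trig_poly_mult unfolding f g by blast
    then have "(\<lambda>x. f x * g x) = trig_poly N" by auto
    then show "(\<lambda>x. f x * g x) \<in> range trig_poly" by blast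
  next
    fix c :: real
    have "(\<lambda>_. c) = trig_poly [(of_real c, [])]" by (auto simp: trig_poly_Cons)
    then show "(\<lambda>_. c) \<in> range trig_poly" by blast
  next
    fix x y :: torus
    assume "x \<noteq> y"
    then obtain i where "x i \<noteq> y i" by blast
    then have "circle_exp (x i) \<noteq> circle_exp (y i)" using inj_circle_exp by (simp add: inj_eq)
    \<comment> \<open>The coefficient \<open>\<i>\<close> yields minus the imaginary part, and
      distinct complex numbers differ in their real or in their imaginary part.\<close>
    then have "trig_poly [(1, [(True, i)])] x \<noteq> trig_poly [(1, [(True, i)])] y \<or>
      trig_poly [(\<i>, [(True, i)])] x \<noteq> trig_poly [(\<i>, [(True, i)])] y"
      by (simp add: trig_poly_Cons complex_eq_iff)
    then show "\<exists>f\<in>range trig_poly. f x \<noteq> f y" by blast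
  qed (rule compact_UNIV_torus)
  show ?thesis
    using Stone_Weierstrass_basic[OF assms] by auto
qed

section \<open>Averages along the multiples of a group element\<close>

lemma translation_pow_add: "(((+) h) ^^ k) y = y + (((+) h) ^^ k) (0 :: torus)"
  by (induction k) (auto simp: add_ac)

text \<open>The iterate \<open>((+) h) ^^ k\<close> stands for translation by the k-fold multiple of
  \<open>h\<close>.\<close>

lemma character_translation_pow:
  "character l ((((+) h) ^^ k) y) = character l h ^ k * character l y"
  by (induction k) (simp_all only: funpow.simps o_apply id_apply character_add power.simps
    mult_1 mult.assoc)

text \<open>For z different from 1 the geometric sums stay bounded, so division by n sends them to
  0; for z = 1 all summands are equal.\<close>

lemma geometric_average_tendsto:
  fixes z :: complex
  assumes "norm z = 1"
  shows "(\<lambda>n. (\<Sum>k<n. Re (c * z ^ k)) / n) \<longlonglongrightarrow> (if z = 1 then Re c else 0)"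
proof (cases "z = 1")
  case True
  have "\<forall>\<^sub>F n in sequentially. (\<Sum>k<n. Re (c * z ^ k)) / real n = Re c"
    using eventually_gt_at_top[of 0] by eventually_elim (simp add: True)
  then show ?thesis
    using True by (simp add: tendsto_eventually)
next
  case False
  \<comment> \<open>Since |1 - z^n| is at most 2, this bounds |c (1 - z^n) / (1 - z)| for every
    n.\<close>
  define B where "B = norm c * 2 / norm (1 - z)"
  have bound: "\<bar>(\<Sum>k<n. Re (c * z ^ k)) / n\<bar> \<le> B / n" for n :: nat
  proof -
    have "norm (1 - z ^ n) \<le> 2"
      using norm_triangle_ineq4[of 1 "z ^ n"] assms by (simp add: norm_power)
    then have B: "norm c * norm (1 - z ^ n) / norm (1 - z) \<le> B"
      unfolding B_def by (intro divide_right_mono mult_left_mono) auto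
    have "(\<Sum>k<n. Re (c * z ^ k)) = Re (c * (\<Sum>k<n. z ^ k))"
      by (simp only: sum_distrib_left Re_sum)
    also have "(\<Sum>k<n. z ^ k) = (1 - z ^ n) / (1 - z)"
      using False by (simp add: sum_gp_strict)
    also have "\<bar>Re (c * ((1 - z ^ n) / (1 - z)))\<bar> \<le> norm (c * ((1 - z ^ n) / (1 - z)))"
      by (rule abs_Re_le_cmod)
    also have "\<dots> = norm c * norm (1 - z ^ n) / norm (1 - z)"
      by (simp only: norm_mult norm_divide times_divide_eq_right)
    also note B
    finally have "\<bar>\<Sum>k<n. Re (c * z ^ k)\<bar> / real n \<le> B / real n"
      by (rule divide_right_mono) simp
    then show ?thesis by (simp only: abs_divide abs_of_nat)
  qed
  have "(\<lambda>n. (\<Sum>k<n. Re (c * z ^ k)) / n) \<longlonglongrightarrow> 0"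
  proof (rule Lim_null_comparison)
    show "(\<lambda>n. B / real n) \<longlonglongrightarrow> 0" by (rule lim_const_over_n)
    show "\<forall>\<^sub>F n in sequentially. norm ((\<Sum>k<n. Re (c * z ^ k)) / real n) \<le> B / real n"
      using bound by (intro always_eventually allI) (simp only: real_norm_def)
  qed
  then show ?thesis using False by simp
qed

text \<open>Translation by \<open>h\<close> multiplies the term with word \<open>l\<close> by the
  unit number \<open>character l h\<close>, so the geometric average applies to each term.\<close>

lemma trig_poly_average_tendsto:
  "(\<lambda>n. (\<Sum>k<n. trig_poly L ((((+) h) ^^ k) y)) / n)
    \<longlonglongrightarrow> trig_poly (filter (\<lambda>(c, l). character l h = 1) L) y"
proof (induction L)
  case Nil
  show ?case by simp
next
  case (Cons p L)
  obtain c l where p: "p = (c, l)" by fastforce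
  have "(\<Sum>k<n. trig_poly (p # L) ((((+) h) ^^ k) y)) / n
    = (\<Sum>k<n. Re ((c * character l y) * character l h ^ k)) / n
      + (\<Sum>k<n. trig_poly L ((((+) h) ^^ k) y)) / n" for n :: nat
    by (simp only: p trig_poly_Cons character_translation_pow sum.distrib add_divide_distrib mult_ac)
  moreover have "trig_poly (filter (\<lambda>(c, l). character l h = 1) (p # L)) y
    = (if character l h = 1 then Re (c * character l y) else 0)
      + trig_poly (filter (\<lambda>(c, l). character l h = 1) L) y"
    by (simp add: p trig_poly_Cons del: times_complex.sel)
  ultimately show ?case
    by (simp only:) (intro tendsto_add geometric_average_tendsto norm_character Cons)
qed

lemma trig_poly_filter_bounds:
  assumes "\<And>k. trig_poly L ((((+) h) ^^ k) y) \<in> {a..b}"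
  shows "trig_poly (filter (\<lambda>(c, l). character l h = 1) L) y \<in> {a..b}"
proof -
  \<comment> \<open>At n = 0 the quotient is 0 by convention and may lie outside the
    interval.\<close>
  have "(\<Sum>k<n. trig_poly L ((((+) h) ^^ k) y)) / n \<in> {a..b}" if "n \<ge> 1" for n :: nat
  proof -
    have "n * a \<le> (\<Sum>k<n. trig_poly L ((((+) h) ^^ k) y))"
      using sum_bounded_below[of "{..<n}" a "\<lambda>k. trig_poly L ((((+) h) ^^ k) y)"] assms by simp
    moreover have "(\<Sum>k<n. trig_poly L ((((+) h) ^^ k) y)) \<le> n * b"
      using sum_bounded_above[of "{..<n}" "\<lambda>k. trig_poly L ((((+) h) ^^ k) y)" b] assms by simp
    ultimately show ?thesis using that by (auto simp: field_simps)
  qed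
  then show ?thesis
    by (intro Lim_in_closed_set[OF closed_atLeastAtMost _ _ trig_poly_average_tendsto]
        eventually_sequentiallyI[of 1]) simp_all
qed

text \<open>Averaging over the translates by multiples of some \<open>h \<in> H\<close> keeps the bounds and removes the
  terms whose character is nontrivial at \<open>h\<close>. When only characters trivial on \<open>H\<close> remain, the
  polynomial takes the same value at \<open>0\<close> and at \<open>x\<close>.\<close>

lemma trig_poly_bounds_glue:
  assumes add: "\<And>u v. u \<in> H \<Longrightarrow> v \<in> H \<Longrightarrow> u + v \<in> H" and 0: "0 \<in> H"
    and triv: "\<And>l. (\<And>h. h \<in> H \<Longrightarrow> character l h = 1) \<Longrightarrow> character l x = 1"
    and "\<And>h. h \<in> H \<Longrightarrow> trig_poly L h \<in> {a..b}"
    and "\<And>h. h \<in> H \<Longrightarrow> trig_poly L (x + h) \<in> {c..d}"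
  shows "c \<le> b"
  using assms(4-)
proof (induction "length L" arbitrary: L rule: less_induct)
  case less
  show ?case
  proof (cases "\<exists>(c, l)\<in>set L. \<exists>h\<in>H. character l h \<noteq> 1")
    case False
    then have "\<forall>(c, l)\<in>set L. character l x = 1" using triv by fastforce
    then have "trig_poly L x = trig_poly L 0"
      by (induction L) (auto simp: trig_poly_Cons)
    then show ?thesis using less(2,3)[OF 0] by simp
  next
    case True
    then obtain c0 l h where h: "(c0, l) \<in> set L" "h \<in> H" "character l h \<noteq> 1" by fast
    define L' where "L' = filter (\<lambda>(c, l). character l h = 1) L"
    have pow: "(((+) h) ^^ k) u \<in> H" if "u \<in> H" for u k
      using that by (induction k) (auto intro: add h)
    have "length L' < length L"
      unfolding L'_def using h by (intro length_filter_less[of "(c0, l)"]) auto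
    moreover have "trig_poly L' u \<in> {a..b}" if "u \<in> H" for u
      unfolding L'_def by (intro trig_poly_filter_bounds less pow that)
    moreover have "trig_poly L' (x + u) \<in> {c..d}" if "u \<in> H" for u
      unfolding L'_def
    proof (rule trig_poly_filter_bounds)
      fix k
      have "(((+) h) ^^ k) (x + u) = x + (((+) h) ^^ k) u"
        by (subst (1 2) translation_pow_add) (simp add: add.assoc)
      then show "trig_poly L ((((+) h) ^^ k) (x + u)) \<in> {c..d}" using less(3) pow that by metis
    qed
    ultimately show ?thesis by (rule less.hyps)
  qed
qed

text \<open>Otherwise a trigonometric polynomial close to the distance from \<open>H\<close> would
  be small on \<open>H\<close> and large on the coset x + H, which
  \<open>trig_poly_bounds_glue\<close> forbids.\<close>

theorem character_separates_closed_subgroup: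
  fixes x :: torus
  assumes H: "H \<in> closed_subgroups" and x: "x \<notin> H"
  shows "\<exists>l. (\<forall>h\<in>H. character l h = 1) \<and> character l x \<noteq> 1"
proof (rule ccontr)
  assume "\<not> ?thesis"
  then have triv: "(\<And>h. h \<in> H \<Longrightarrow> character l h = 1) \<Longrightarrow> character l x = 1" for l by blast
  have cl: "closed H" and 0: "0 \<in> H" and add: "\<And>u v. u \<in> H \<Longrightarrow> v \<in> H \<Longrightarrow> u + v \<in> H"
    and neg: "\<And>u. u \<in> H \<Longrightarrow> - u \<in> H"
    using H by (auto simp: closed_subgroups_def)
  have cmp: "compact H" using cl by (simp add: compact_torus_iff_closed)
  have cont: "continuous_on A (\<lambda>y. infdist y H)" for A
    by (intro continuous_intros)
  have "continuous_on H (\<lambda>h. infdist (x + h) H)"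
    by (intro continuous_intros)
  \<comment> \<open>The minimum over the coset is attained by compactness, so it is positive once
    the coset misses the closed set \<open>H\<close>.\<close>
  then obtain h0 where h0: "h0 \<in> H" "\<And>h. h \<in> H \<Longrightarrow> infdist (x + h0) H \<le> infdist (x + h) H"
    using continuous_attains_inf[OF cmp, of "\<lambda>h. infdist (x + h) H"] 0 by blast
  define \<delta> where "\<delta> = infdist (x + h0) H"
  have "x + h0 \<notin> H"
    using add[OF _ neg[OF h0(1)], of "x + h0"] x by (auto simp: add.assoc)
  then have "\<delta> > 0"
    unfolding \<delta>_def using 0 cl by (metis empty_iff in_closed_iff_infdist_zero infdist_nonneg less_eq_real_def)
  \<comment> \<open>With error \<open>\<delta> / 3\<close> the polynomial is at most
    \<open>\<delta> / 3\<close> on \<open>H\<close> and at least \<open>2 * \<delta> / 3\<close> on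
    the coset.\<close>
  then obtain L where L: "\<And>y. \<bar>infdist y H - trig_poly L y\<bar> < \<delta> / 3"
    using trig_poly_dense[OF cont, of "\<delta> / 3"] by auto
  \<comment> \<open>The gluing lemma asks for two-sided bounds on the coset; compactness supplies
    the upper one.\<close>
  obtain B where B: "\<And>y. infdist y H \<le> B"
    using continuous_attains_sup[OF compact_UNIV_torus UNIV_not_empty cont] by blast
  have "2 * \<delta> / 3 \<le> \<delta> / 3"
  proof (rule trig_poly_bounds_glue[OF add 0 triv])
    show "trig_poly L h \<in> {- \<delta> / 3..\<delta> / 3}" if "h \<in> H" for h
      using L[of h] that by (simp add: abs_if split: if_splits)
    show "trig_poly L (x + h) \<in> {2 * \<delta> / 3..B + \<delta> / 3}" if "h \<in> H" for h
      using L[of "x + h"] B[of "x + h"] h0(2)[OF that] by (simp add: \<delta>_def abs_if split: if_splits)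
  qed
  then show False using \<open>\<delta> > 0\<close> by simp
qed

section \<open>The Borel structure of the Chabauty space\<close>

text \<open>Under Pontryagin duality this is the set of subgroups of the direct sum of copies of the
  integers that contain finitely many given elements.\<close>

definition cyl :: "(bool \<times> nat) list list \<Rightarrow> torus set set"
  where "cyl F = {H \<in> closed_subgroups. \<forall>l\<in>set F. \<forall>h\<in>H. character l h = 1}"

lemma cyl_Nil [simp]: "cyl [] = closed_subgroups"
  by (simp add: cyl_def)

lemma cyl_append: "cyl (F @ G) = cyl F \<inter> cyl G"
  by (auto simp: cyl_def)

lemma cyl_subset: "cyl F \<subseteq> closed_subgroups"
  by (auto simp: cyl_def)

text \<open>While w stays within 1/2 of 1, w + 1 has norm at least 3/2, so squaring stretches the
  distance to 1 by at least 3/2. A nonzero distance would eventually exceed any bound.\<close>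

lemma eq_one_if_doublings_near_one:
  fixes z :: complex
  assumes z: "norm z = 1" and near: "\<And>n. norm (z ^ (2 ^ n) - 1) < 1 / 2"
  shows "z = 1"
proof (rule ccontr)
  assume "z \<noteq> 1"
  have growth: "(3 / 2) ^ n * norm (z - 1) \<le> norm (z ^ (2 ^ n) - 1)" for n
  proof (induction n)
    case 0
    show ?case by simp
  next
    case (Suc n)
    define w where "w = z ^ (2 ^ n)"
    have w: "norm (w - 1) < 1 / 2" unfolding w_def by (rule near)
    have "norm (2 :: complex) \<le> norm (w + 1) + norm (w - 1)"
      using norm_triangle_ineq4[of "w + 1" "w - 1"] by simp
    then have "3 / 2 \<le> norm (w + 1)" using w by simp
    then have "(3 / 2) * norm (w - 1) \<le> norm (w + 1) * norm (w - 1)"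
      by (intro mult_right_mono) auto
    also have "\<dots> = norm (w ^ 2 - 1)"
      by (simp only: norm_mult[symmetric]) (simp add: algebra_simps power2_eq_square)
    also have "w ^ 2 = z ^ (2 ^ Suc n)"
      by (simp add: w_def mult.commute flip: power_mult)
    finally show ?case using Suc unfolding w_def by simp
  qed
  obtain n where n: "1 / norm (z - 1) < (3 / 2 :: real) ^ n"
    using real_arch_pow[of "3 / 2"] by auto
  have "1 < (3 / 2) ^ n * norm (z - 1)"
    using n \<open>z \<noteq> 1\<close> by (simp add: field_simps)
  then show False using growth[of n] near[of n] by linarith
qed

lemma closed_subgroup_translation_pow:
  assumes "H \<in> closed_subgroups" "h \<in> H"
  shows "(((+) h) ^^ k) 0 \<in> H"
proof (induction k)
  case 0
  show ?case using assms(1) by (simp add: closed_subgroups_def)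
next
  case (Suc k)
  then have "h + (((+) h) ^^ k) 0 \<in> H" using assms by (simp add: closed_subgroups_def)
  then show ?case by (simp only: funpow.simps o_apply)
qed

text \<open>A closed subgroup on which a character stays near 1 lies in its kernel, as the circle has no
  small subgroups. This is what makes cylinders open.\<close>

lemma cyl_single_eq_miss:
  "cyl [l] = {H \<in> closed_subgroups. H \<inter> {x. 1 / 2 \<le> norm (character l x - 1)} = {}}"
proof (intro equalityI subsetI)
  fix H assume H: "H \<in> {H \<in> closed_subgroups. H \<inter> {x. 1 / 2 \<le> norm (character l x - 1)} = {}}"
  have "character l h = 1" if "h \<in> H" for h
  proof (rule eq_one_if_doublings_near_one)
    fix n
    have "(((+) h) ^^ (2 ^ n)) 0 \<in> H"
      using closed_subgroup_translation_pow H that by blast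
    then have "\<not> 1 / 2 \<le> norm (character l ((((+) h) ^^ (2 ^ n)) 0) - 1)"
      using H by blast
    then show "norm (character l h ^ (2 ^ n) - 1) < 1 / 2"
      by (simp only: character_translation_pow character_zero mult_1_right not_le)
  qed simp
  then show "H \<in> cyl [l]" using H by (simp add: cyl_def)
qed (auto simp: cyl_def)

lemma openin_cyl: "openin chabauty (cyl F)"
proof (induction F)
  case Nil
  show ?case using openin_topspace[of "chabauty :: torus set topology"] by simp
next
  case (Cons l F)
  have "closed {x. 1 / 2 \<le> norm (character l x - 1)}"
    by (intro closed_Collect_le continuous_intros continuous_character)
  then have "openin chabauty (cyl [l])"
    unfolding cyl_single_eq_miss
    by (intro openin_chabauty_miss) (simp add: compact_torus_iff_closed)
  moreover have "cyl (l # F) = cyl [l] \<inter> cyl F" using cyl_append[of "[l]" F] by simp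
  ultimately show ?case using Cons by auto
qed

text \<open>Violating a character is a hit condition for the open set where it differs from 1. With
  \<open>openin_cyl\<close> this makes cylinders clopen.\<close>

lemma openin_compl_cyl: "openin chabauty (closed_subgroups - cyl F)"
proof (induction F)
  case Nil
  show ?case by simp
next
  case (Cons l F)
  have "open {x. character l x \<noteq> 1}"
    by (intro open_Collect_neq continuous_character) simp
  then have "openin chabauty {H \<in> closed_subgroups. H \<inter> {x. character l x \<noteq> 1} \<noteq> {}}"
    by (rule openin_chabauty_hit)
  moreover have "closed_subgroups - cyl (l # F)
    = {H \<in> closed_subgroups. H \<inter> {x. character l x \<noteq> 1} \<noteq> {}} \<union> (closed_subgroups - cyl F)"
    by (auto simp: cyl_def)
  ultimately show ?case using Cons by auto
qed

text \<open>Duality excludes each point of \<open>K\<close> by a character trivial on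
  \<open>H\<close>, and compactness leaves finitely many of these characters.\<close>

lemma cyl_avoids_compact:
  assumes H: "H \<in> closed_subgroups" and K: "compact K" "H \<inter> K = {}"
  shows "\<exists>F. H \<in> cyl F \<and> (\<forall>H'\<in>cyl F. H' \<inter> K = {})"
proof -
  define T where "T = {l. \<forall>h\<in>H. character l h = 1}"
  have op: "open {x. character l x \<noteq> 1}" for l
    by (intro open_Collect_neq continuous_character) simp
  have cover: "K \<subseteq> (\<Union>l\<in>T. {x. character l x \<noteq> 1})"
    using character_separates_closed_subgroup[OF H] K(2) unfolding T_def by blast
  obtain T' where T': "T' \<subseteq> T" "finite T'" "K \<subseteq> (\<Union>l\<in>T'. {x. character l x \<noteq> 1})"
    by (rule compactE_image[OF K(1) op cover])
  obtain F where F: "set F = T'" using finite_list[OF T'(2)] by blast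
  have "H \<in> cyl F" using H T'(1) by (auto simp: cyl_def F T_def)
  moreover have "H' \<inter> K = {}" if "H' \<in> cyl F" for H'
    using that T'(3) by (auto simp: cyl_def F)
  ultimately show ?thesis by blast
qed

text \<open>The balls are closed so that hitting one is the complement of missing a compact set,
  where \<open>cyl_avoids_compact\<close> applies.\<close>

lemma torus_countable_closed_base:
  "\<exists>\<K> :: torus set set. countable \<K> \<and> (\<forall>K\<in>\<K>. compact K) \<and>
    (\<forall>U x. open U \<longrightarrow> x \<in> U \<longrightarrow> (\<exists>K\<in>\<K>. x \<in> K \<and> K \<subseteq> U))"
proof -
  have tb: "\<forall>\<epsilon>>0. \<exists>k. finite k \<and> (UNIV :: torus set) \<subseteq> (\<Union>x\<in>k. ball x \<epsilon>)"
    using compact_UNIV_torus unfolding compact_eq_totally_bounded by (rule conjunct2)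
  have "\<forall>n::nat. \<exists>k. finite k \<and> (UNIV :: torus set) \<subseteq> (\<Union>x\<in>k. ball x (1 / Suc n))"
    by (intro allI tb[rule_format]) simp
  from choice[OF this] obtain k where
    "\<forall>n. finite (k n) \<and> (UNIV :: torus set) \<subseteq> (\<Union>x\<in>k n. ball x (1 / Suc n))" ..
  then have k: "finite (k n)" "(UNIV :: torus set) \<subseteq> (\<Union>x\<in>k n. ball x (1 / Suc n))" for n
    by blast+
  define \<K> where "\<K> = (\<Union>n. (\<lambda>x. cball x (1 / Suc n)) ` k n)"
  have "\<forall>U x. open U \<longrightarrow> x \<in> U \<longrightarrow> (\<exists>K\<in>\<K>. x \<in> K \<and> K \<subseteq> U)"
  proof (intro allI impI)
    fix U :: "torus set" and x assume U: "open U" "x \<in> U"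
    obtain e where e: "e > 0" "ball x e \<subseteq> U" by (rule openE[OF U])
    obtain n where n: "inverse (real (Suc n)) < e / 2"
      using reals_Archimedean[of "e / 2"] e(1) by auto
    obtain y where y: "y \<in> k n" "x \<in> ball y (1 / Suc n)" using k(2)[of n] by blast
    have "cball y (1 / Suc n) \<subseteq> ball x e"
    proof
      fix z assume "z \<in> cball y (1 / Suc n)"
      then have "dist y z \<le> inverse (Suc n)" by (simp add: inverse_eq_divide)
      moreover have "dist x y < inverse (Suc n)" using y(2) by (simp add: dist_commute inverse_eq_divide)
      ultimately have "dist x z < e" using dist_triangle[of x z y] n by linarith
      then show "z \<in> ball x e" by simp
    qed
    moreover have "cball y (1 / Suc n) \<in> \<K>" unfolding \<K>_def using y(1) by blast
    moreover have "x \<in> cball y (1 / Suc n)" using y(2) by simp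
    ultimately show "\<exists>K\<in>\<K>. x \<in> K \<and> K \<subseteq> U" using e(2) by blast
  qed
  moreover have "countable \<K>"
    unfolding \<K>_def by (intro countable_UN countableI_type countable_image countable_finite k(1))
  moreover have "\<forall>K\<in>\<K>. compact K"
    unfolding \<K>_def by (simp add: compact_torus_iff_closed)
  ultimately show ?thesis by (intro exI[of _ \<K>] conjI)
qed

text \<open>Every cylinder contains the trivial subgroup, so cylinders alone are not a base of the
  topology. The sets \<open>D (F, S)\<close> add finitely many hit conditions taken from a countable
  family. They form a countable base, hence every open set is a countable union of sets that
  cylinders generate.\<close>

lemma sets_borel_chabauty:
  "sets (borel_of_top chabauty) = sigma_sets closed_subgroups (range cyl)"
proof -
  let ?S = "sigma_sets closed_subgroups (range cyl)"
  interpret S: sigma_algebra closed_subgroups ?S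
    using cyl_subset by (intro sigma_algebra_sigma_sets) (simp add: image_subset_iff)
  from torus_countable_closed_base obtain \<K> :: "torus set set" where "countable \<K> \<and> (\<forall>K\<in>\<K>. compact K) \<and>
    (\<forall>U x. open U \<longrightarrow> x \<in> U \<longrightarrow> (\<exists>K\<in>\<K>. x \<in> K \<and> K \<subseteq> U))" ..
  then have \<K>: "countable \<K>" "\<And>K. K \<in> \<K> \<Longrightarrow> compact K"
    "\<And>U x. open U \<Longrightarrow> x \<in> U \<Longrightarrow> \<exists>K\<in>\<K>. x \<in> K \<and> K \<subseteq> U"
    by simp_all
  have cyl: "cyl F \<in> ?S" for F by (rule sigma_sets.Basic) simp
  define hit :: "torus set \<Rightarrow> torus set set" where "hit K = {H \<in> closed_subgroups. H \<inter> K \<noteq> {}}" for K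
  have hit: "hit K \<in> ?S" if "K \<in> \<K>" for K
  proof -
    \<comment> \<open>There are only countably many lists of words, so the union on the right is
      countable.\<close>
    have "{H \<in> closed_subgroups. H \<inter> K = {}} = (\<Union>F\<in>{F. \<forall>H\<in>cyl F. H \<inter> K = {}}. cyl F)"
    proof (intro equalityI subsetI)
      fix H assume "H \<in> {H \<in> closed_subgroups. H \<inter> K = {}}"
      then obtain F where "H \<in> cyl F" "\<forall>H'\<in>cyl F. H' \<inter> K = {}"
        using cyl_avoids_compact[OF _ \<K>(2)[OF \<open>K \<in> \<K>\<close>]] by blast
      then show "H \<in> (\<Union>F\<in>{F. \<forall>H\<in>cyl F. H \<inter> K = {}}. cyl F)" by blast
    next
      fix H assume "H \<in> (\<Union>F\<in>{F. \<forall>H\<in>cyl F. H \<inter> K = {}}. cyl F)"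
      then show "H \<in> {H \<in> closed_subgroups. H \<inter> K = {}}" using cyl_subset by fast
    qed
    also have "\<dots> \<in> ?S"
      by (intro S.countable_UN' countableI_type) (use cyl in blast)
    finally have "closed_subgroups - {H \<in> closed_subgroups. H \<inter> K = {}} \<in> ?S"
      by (rule S.compl_sets)
    also have "closed_subgroups - {H \<in> closed_subgroups. H \<inter> K = {}} = hit K"
      unfolding hit_def by blast
    finally show ?thesis .
  qed
  define D where "D = (\<lambda>(F, S). cyl F \<inter> {H. \<forall>K\<in>S. H \<in> hit K})"
  define \<D> where "\<D> = D ` (UNIV \<times> {S. finite S \<and> S \<subseteq> \<K>})"
  have "countable {S. finite S \<and> S \<subseteq> \<K>}" using \<K>(1) by (rule countable_Collect_finite_subset)
  then have count: "countable \<D>" unfolding \<D>_def by auto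
  have D_sets: "W \<in> ?S" if W: "W \<in> \<D>" for W
  proof -
    obtain F S where S: "W = D (F, S)" "finite S" "S \<subseteq> \<K>" using W unfolding \<D>_def by blast
    have "cyl F \<inter> {H. \<forall>K\<in>S. H \<in> hit K} \<in> ?S"
      using S(2,3)
    proof (induction S)
      case empty
      show ?case using cyl by simp
    next
      case (insert K S)
      have "cyl F \<inter> {H. \<forall>K\<in>insert K S. H \<in> hit K} = hit K \<inter> (cyl F \<inter> {H. \<forall>K\<in>S. H \<in> hit K})"
        by blast
      then show ?case using insert hit by auto
    qed
    then show ?thesis by (simp add: S(1) D_def)
  qed
  have base: "\<exists>V\<in>\<D>. H \<in> V \<and> V \<subseteq> W" if "openin chabauty W" "H \<in> W" for W H
  proof -
    have "generate_topology_on ({{H \<in> closed_subgroups. H \<inter> K = {}} |K. compact K} \<union>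
        {{H \<in> closed_subgroups. H \<inter> U \<noteq> {}} |U. open U}) W"
      using that(1) unfolding chabauty_def by (simp add: openin_topology_generated_by)
    then show ?thesis using that(2)
    proof (induction arbitrary: H)
      case Empty
      then show ?case by simp
    next
      case (Int a b)
      from Int.prems have "H \<in> a" "H \<in> b" by simp_all
      from Int.IH(1)[OF this(1)] Int.IH(2)[OF this(2)]
      obtain V V' where V: "V \<in> \<D>" "H \<in> V" "V \<subseteq> a" "V' \<in> \<D>" "H \<in> V'" "V' \<subseteq> b"
        by (elim bexE conjE)
      obtain F S F' S' where FS: "V = D (F, S)" "finite S" "S \<subseteq> \<K>" "V' = D (F', S')" "finite S'" "S' \<subseteq> \<K>"
        using V unfolding \<D>_def by blast
      have "V \<inter> V' = D (F @ F', S \<union> S')" by (auto simp: FS D_def cyl_append)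
      moreover have "D (F @ F', S \<union> S') \<in> \<D>" unfolding \<D>_def using FS by (intro imageI) auto
      ultimately have "V \<inter> V' \<in> \<D>" by simp
      then show ?case using V(2,3,5,6) by (intro bexI[of _ "V \<inter> V'"] conjI IntI Int_mono)
    next
      case (UN \<U>)
      then obtain k where k: "k \<in> \<U>" "H \<in> k" by blast
      from UN.IH[OF this] k(1) show ?case by blast
    next
      case (Basis s)
      from Basis(1) consider K where "compact K" "s = {H \<in> closed_subgroups. H \<inter> K = {}}"
        | U where "open U" "s = {H \<in> closed_subgroups. H \<inter> U \<noteq> {}}" by blast
      then show ?case
      proof cases
        case K: 1
        then obtain F where F: "H \<in> cyl F" "\<forall>H'\<in>cyl F. H' \<inter> K = {}"
          using cyl_avoids_compact[of H K] Basis(2) by blast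
        have "D (F, {}) = cyl F" by (simp add: D_def)
        moreover have "D (F, {}) \<in> \<D>" unfolding \<D>_def by (intro imageI) auto
        ultimately have "cyl F \<in> \<D>" by simp
        moreover have "cyl F \<subseteq> s" unfolding K(2) using F(2) cyl_subset by blast
        ultimately show ?thesis using F(1) by (intro bexI[of _ "cyl F"] conjI)
      next
        case U: 2
        then obtain x where x: "x \<in> H" "x \<in> U" and H: "H \<in> closed_subgroups" using Basis(2) by blast
        obtain K where K: "K \<in> \<K>" "x \<in> K" "K \<subseteq> U" using \<K>(3)[OF U(1) x(2)] by blast
        have "D ([], {K}) = hit K" by (auto simp: D_def hit_def)
        moreover have "D ([], {K}) \<in> \<D>" unfolding \<D>_def using K(1) by (intro imageI) auto
        ultimately have "hit K \<in> \<D>" by simp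
        moreover have "H \<in> hit K" "hit K \<subseteq> s"
          using K(2,3) x H unfolding hit_def U(2) by blast+
        ultimately show ?thesis by (intro bexI[of _ "hit K"] conjI)
      qed
    qed
  qed
  have "W \<in> ?S" if "openin chabauty W" for W
  proof -
    have "W = (\<Union>V\<in>{V \<in> \<D>. V \<subseteq> W}. V)" using base[OF that] by blast
    moreover have "\<dots> \<in> ?S"
      using D_sets count by (intro S.countable_UN') (auto intro: countable_subset[OF _ count])
    ultimately show ?thesis by simp
  qed
  then have "sigma_sets closed_subgroups {W. openin chabauty W} \<subseteq> ?S"
    by (intro S.sigma_sets_subset) auto
  moreover have "?S \<subseteq> sigma_sets closed_subgroups {W. openin chabauty W}"
    by (intro sigma_sets_mono') (use openin_cyl in auto)
  moreover have "{W. openin chabauty W} \<subseteq> Pow (closed_subgroups :: torus set set)"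
    using openin_subset[where U = "chabauty :: torus set topology"] by auto
  ultimately show ?thesis
    unfolding borel_of_top_def by (simp add: sets_measure_of)
qed

lemma space_borel_chabauty [simp]: "space (borel_of_top chabauty) = closed_subgroups"
proof -
  have "{W. openin chabauty W} \<subseteq> Pow (closed_subgroups :: 'a set set)"
    using openin_subset[where U = "chabauty :: 'a set topology"] by auto
  then show ?thesis unfolding borel_of_top_def by (simp add: space_measure_of)
qed

lemma cyl_sets [measurable, simp]: "cyl F \<in> sets (borel_of_top chabauty)"
  by (simp add: sets_borel_chabauty sigma_sets.Basic)

lemma borel_probs_chabautyD:
  assumes "\<mu> \<in> borel_probs chabauty"
  shows "prob_space \<mu>" "sets \<mu> = sets (borel_of_top chabauty)" "space \<mu> = closed_subgroups"
  using assms sets_eq_imp_space_eq[of \<mu> "borel_of_top chabauty"] by (auto simp: borel_probs_def)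

text \<open>Cylinders are closed under intersection and generate the Borel sets, so Dynkin's
  uniqueness theorem applies.\<close>

lemma borel_probs_eqI:
  assumes \<mu>: "\<mu> \<in> borel_probs chabauty" and \<nu>: "\<nu> \<in> borel_probs chabauty"
    and eq: "\<And>F. measure \<mu> (cyl F) = measure \<nu> (cyl F)"
  shows "\<mu> = \<nu>"
proof -
  interpret M: prob_space \<mu> using \<mu> by (rule borel_probs_chabautyD)
  interpret N: prob_space \<nu> using \<nu> by (rule borel_probs_chabautyD)
  have "Int_stable (range cyl)"
    by (auto simp: Int_stable_def simp flip: cyl_append)
  then show ?thesis
    by (rule measure_eqI_generator_eq[where \<Omega> = closed_subgroups and A = "\<lambda>_. cyl []"])
      (use eq cyl_subset borel_probs_chabautyD[OF \<mu>] borel_probs_chabautyD[OF \<nu>]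
        in \<open>auto simp: sets_borel_chabauty M.emeasure_eq_measure N.emeasure_eq_measure
          simp del: cyl_Nil\<close>, auto)
qed

section \<open>Reindexing the coordinates\<close>

definition reindex :: "(nat \<Rightarrow> nat) \<Rightarrow> (bool \<times> nat) list list \<Rightarrow> (bool \<times> nat) list list"
  where "reindex f F = map (map (apsnd f)) F"

definition support :: "(bool \<times> nat) list list \<Rightarrow> nat set"
  where "support F = (\<Union>l\<in>set F. snd ` set l)"

lemma finite_support: "finite (support F)"
  by (simp add: support_def)

lemma support_reindex: "support (reindex f F) = f ` support F"
  by (fastforce simp: support_def reindex_def image_iff)

lemma reindex_cong: "(\<And>i. i \<in> support F \<Longrightarrow> f i = g i) \<Longrightarrow> reindex f F = reindex g F"
  by (fastforce simp: reindex_def support_def apsnd_def map_prod_def)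

text \<open>Closedness of the image comes from compactness of the torus rather than from a
  continuous inverse, which covers maps that forget coordinates.\<close>

lemma image_closed_subgroups:
  fixes T :: "torus \<Rightarrow> torus"
  assumes add: "\<And>x y. T (x + y) = T x + T y" and cont: "continuous_on UNIV T"
    and H: "H \<in> closed_subgroups"
  shows "T ` H \<in> closed_subgroups"
proof -
  have 0: "T 0 = 0" using add[of 0 0] by (metis add.right_neutral add_left_cancel)
  have neg: "T (- x) = - T x" for x
    using add[of "- x" x] 0 by (simp add: eq_neg_iff_add_eq_0)
  have "compact H" using H by (simp add: compact_torus_iff_closed closed_subgroups_def)
  then have "compact (T ` H)"
    using cont compact_continuous_image continuous_on_subset by blast
  then have "closed (T ` H)" by (rule compact_imp_closed)
  moreover have "0 \<in> T ` H"
    using H by (intro image_eqI[where x = 0]) (simp_all add: 0 closed_subgroups_def)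
  ultimately show ?thesis
    using H by (auto simp: closed_subgroups_def add[symmetric] neg[symmetric] simp del: plus_fun_apply)
qed

text \<open>A permutation \<open>f\<close> gives an automorphism; \<open>\<lambda>i. i + n\<close>
  gives the map that forgets the first \<open>n\<close> coordinates and renumbers the
  others.\<close>

definition coords :: "(nat \<Rightarrow> nat) \<Rightarrow> torus \<Rightarrow> torus"
  where "coords f x = (\<lambda>i. x (f i))"

lemma continuous_coords: "continuous_on A (coords f)"
  unfolding coords_def
  by (intro continuous_on_coordinatewise_then_product continuous_on_torus_coordinate)

lemma coords_add: "coords f (x + y) = coords f x + coords f y"
  by (auto simp: coords_def)

lemma coords_closed_subgroups: "H \<in> closed_subgroups \<Longrightarrow> coords f ` H \<in> closed_subgroups"
  by (intro image_closed_subgroups coords_add continuous_coords)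

lemma coords_image_cyl:
  "H \<in> closed_subgroups \<Longrightarrow> coords f ` H \<in> cyl F \<longleftrightarrow> H \<in> cyl (reindex f F)"
  using coords_closed_subgroups[of H f]
  by (simp add: cyl_def reindex_def coords_def character_reindex)

lemma coords_vimage_cyl: "(`) (coords f) -` cyl F \<inter> closed_subgroups = cyl (reindex f F)"
  using coords_image_cyl cyl_subset by blast

lemma measurable_coords: "(`) (coords f) \<in> borel_of_top chabauty \<rightarrow>\<^sub>M borel_of_top chabauty"
  by (rule measurable_sigma_sets[OF sets_borel_chabauty])
    (use cyl_subset coords_closed_subgroups in \<open>auto simp: coords_vimage_cyl\<close>)

lemma coords_Aut:
  assumes "bij f"
  shows "coords f \<in> Aut"
proof -
  have l: "coords (inv f) (coords f x) = x" and r: "coords f (coords (inv f) x) = x" for x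
    using assms by (auto simp: coords_def bij_is_surj surj_f_inv_f bij_is_inj inv_f_f)
  then have "bij (coords f)" by (metis bijI')
  moreover have "inv (coords f) = coords (inv f)" using l r by (metis ext inv_equality)
  ultimately show ?thesis
    using coords_add continuous_coords by (auto simp: Aut_def)
qed

section \<open>Ergodic characteristic random subgroups of the torus\<close>

lemma CRS_prob: "\<mu> \<in> CRS \<Longrightarrow> \<mu> \<in> borel_probs chabauty"
  by (simp add: CRS_def)

lemma CRS_emeasure_vimage:
  assumes \<mu>: "\<mu> \<in> CRS" and \<phi>: "\<phi> \<in> Aut" and A: "A \<in> sets (borel_of_top chabauty)"
  shows "emeasure \<mu> ((`) \<phi> -` A \<inter> closed_subgroups) = emeasure \<mu> A"
proof -
  have sets: "sets \<mu> = sets (borel_of_top chabauty)" and inv: "distr \<mu> (borel_of_top chabauty) ((`) \<phi>) = \<mu>"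
    using \<mu> \<phi> by (auto simp: CRS_def borel_probs_def)
  have space: "space \<mu> = closed_subgroups" using sets_eq_imp_space_eq[OF sets] by simp
  have "(`) \<phi> \<in> \<mu> \<rightarrow>\<^sub>M borel_of_top chabauty"
    using measurable_Aut_image[OF \<phi>] measurable_cong_sets[OF sets refl] by blast
  then have "emeasure (distr \<mu> (borel_of_top chabauty) ((`) \<phi>)) A = emeasure \<mu> ((`) \<phi> -` A \<inter> space \<mu>)"
    using A by (rule emeasure_distr)
  then show ?thesis by (simp only: inv space)
qed

section \<open>Invariance under the shift and independence of disjoint coordinates\<close>

lemma rotation_bij:
  "bij (\<lambda>i. if i < m then (i + n) mod m else i :: nat)"
proof -
  let ?f = "\<lambda>i. if i < m then (i + n) mod m else i :: nat"
  have inj: "inj_on (\<lambda>i. (i + n) mod m) {..<m}"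
  proof (rule inj_onI)
    fix i j assume ij: "i \<in> {..<m}" "j \<in> {..<m}" "(i + n) mod m = (j + n) mod m"
    then have "i mod m = j mod m"
      using nat_mod_eq_iff[of "i + n" m "j + n"] nat_mod_eq_iff[of i m j] by auto
    then show "i = j" using ij by simp
  qed
  have "inj ?f"
  proof (rule injI)
    fix i j assume eq: "?f i = ?f j"
    have lt: "(k + n) mod m < m" if "k < m" for k using that by (intro mod_less_divisor) simp
    show "i = j"
      using eq lt[of i] lt[of j] inj_onD[OF inj, of i j] by (auto split: if_splits)
  qed
  moreover have "?f ` {..<m} = {..<m}"
  proof (rule endo_inj_surj)
    show "inj_on ?f {..<m}" using \<open>inj ?f\<close> by (rule inj_on_subset) simp
    show "?f ` {..<m} \<subseteq> {..<m}" by (auto intro!: mod_less_divisor)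
  qed simp
  then have "k \<in> range ?f" for k
  proof (cases "k < m")
    case True
    then have "k \<in> ?f ` {..<m}" using \<open>?f ` {..<m} = {..<m}\<close> by simp
    then show ?thesis by blast
  next
    case False
    then have "k = ?f k" by simp
    then show ?thesis by (rule range_eqI)
  qed
  ultimately show ?thesis by (intro bijI) auto
qed

text \<open>The shift of indices is not onto, but on the finite support of a cylinder it agrees with
  a permutation.\<close>

lemma CRS_shift:
  assumes "\<mu> \<in> CRS"
  shows "measure \<mu> (cyl (reindex (\<lambda>i. i + n) F)) = measure \<mu> (cyl F)"
proof -
  obtain m where m: "support F \<subseteq> {..<m}"
    using finite_support finite_nat_iff_bounded by blast
  \<comment> \<open>Rotating a block of length \<open>m + n\<close> leaves no wrap-around on indices
    below \<open>m\<close>, where it is the shift by \<open>n\<close>.\<close>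
  define f where "f i = (if i < m + n then (i + n) mod (m + n) else i)" for i :: nat
  have "bij f" unfolding f_def[abs_def] by (rule rotation_bij)
  have "reindex f F = reindex (\<lambda>i. i + n) F"
    using m by (intro reindex_cong) (auto simp: f_def)
  then have "cyl (reindex (\<lambda>i. i + n) F) = (`) (coords f) -` cyl F \<inter> closed_subgroups"
    by (simp add: coords_vimage_cyl)
  then show ?thesis
    using CRS_emeasure_vimage[OF assms coords_Aut[OF \<open>bij f\<close>] cyl_sets[of F]]
    by (simp add: measure_def)
qed

text \<open>Independence of an event in the first \<open>n\<close> coordinates from one in the later
  coordinates. The factor for the shifted cylinder is written as that of \<open>cyl F\<close>; the
  two agree on \<open>CRS\<close> by \<open>CRS_shift\<close>.\<close>

definition multiplicative :: "torus set measure \<Rightarrow> bool"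
  where "multiplicative \<mu> \<longleftrightarrow> (\<forall>F G n. support G \<subseteq> {..<n} \<longrightarrow>
    measure \<mu> (cyl (reindex (\<lambda>i. i + n) F @ G)) = measure \<mu> (cyl F) * measure \<mu> (cyl G))"

section \<open>Automorphisms of the tail, and conditioning on the initial coordinates\<close>

definition extend_id :: "nat \<Rightarrow> (torus \<Rightarrow> torus) \<Rightarrow> torus \<Rightarrow> torus"
  where "extend_id n \<phi> x = (\<lambda>i. if i < n then x i else \<phi> (coords (\<lambda>j. j + n) x) (i - n))"

lemma coords_extend_id: "coords (\<lambda>j. j + n) (extend_id n \<phi> x) = \<phi> (coords (\<lambda>j. j + n) x)"
  by (auto simp: coords_def extend_id_def)

lemma extend_id_comp: "extend_id n \<phi> (extend_id n \<psi> x) = extend_id n (\<lambda>y. \<phi> (\<psi> y)) x"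
  unfolding extend_id_def[of n \<phi>] coords_extend_id by (auto simp: extend_id_def)

lemma extend_id_id: "extend_id n (\<lambda>y. y) x = x"
  by (auto simp: extend_id_def coords_def)

lemma continuous_extend_id:
  assumes "continuous_on UNIV \<phi>"
  shows "continuous_on UNIV (extend_id n \<phi>)"
proof -
  have "continuous_on UNIV (\<lambda>x. \<phi> (coords (\<lambda>j. j + n) x))"
    by (rule continuous_on_compose2[OF assms continuous_coords]) simp
  then have "continuous_on UNIV (\<lambda>x. \<phi> (coords (\<lambda>j. j + n) x) i)" for i
    by (rule continuous_on_compose2[OF continuous_on_torus_coordinate[of UNIV]]) simp
  then have "continuous_on UNIV (\<lambda>x. extend_id n \<phi> x i)" for i
    by (cases "i < n") (simp_all add: extend_id_def continuous_on_torus_coordinate)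
  then show ?thesis by (rule continuous_on_coordinatewise_then_product)
qed

lemma extend_id_Aut:
  assumes "\<phi> \<in> Aut"
  shows "extend_id n \<phi> \<in> Aut"
proof -
  have \<phi>: "bij \<phi>" "\<And>x y. \<phi> (x + y) = \<phi> x + \<phi> y" "continuous_on UNIV \<phi>" "continuous_on UNIV (inv \<phi>)"
    using assms by (simp_all add: Aut_def)
  have l: "extend_id n (inv \<phi>) (extend_id n \<phi> x) = x" for x
    using \<phi>(1) by (simp add: extend_id_comp extend_id_id bij_is_inj inv_f_f)
  have r: "extend_id n \<phi> (extend_id n (inv \<phi>) x) = x" for x
    using \<phi>(1) by (simp add: extend_id_comp extend_id_id bij_is_surj surj_f_inv_f)
  have "bij (extend_id n \<phi>)" by (rule o_bij[of "extend_id n (inv \<phi>)"]) (simp_all add: fun_eq_iff l r)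
  moreover have "inv (extend_id n \<phi>) = extend_id n (inv \<phi>)" using l r by (intro inv_equality)
  moreover have "extend_id n \<phi> (x + y) = extend_id n \<phi> x + extend_id n \<phi> y" for x y
    by (auto simp: extend_id_def coords_add \<phi>(2))
  ultimately show ?thesis
    using \<phi>(3,4) by (simp add: Aut_def continuous_extend_id)
qed

lemma extend_id_image_cyl:
  assumes "\<phi> \<in> Aut" "support G \<subseteq> {..<n}" "H \<in> closed_subgroups"
  shows "extend_id n \<phi> ` H \<in> cyl G \<longleftrightarrow> H \<in> cyl G"
proof -
  have "character l (extend_id n \<phi> x) = character l x" if "l \<in> set G" for l x
  proof (rule character_cong)
    fix i assume "i \<in> snd ` set l"
    then have "i < n" using that assms(2) unfolding support_def by blast
    then show "extend_id n \<phi> x i = x i" by (simp add: extend_id_def)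
  qed
  then show ?thesis
    using Aut_image_closed_subgroups[OF extend_id_Aut[OF assms(1)] assms(3)] assms(3)
    by (simp add: cyl_def)
qed

text \<open>Conditioning on an event that only involves the first \<open>n\<close> coordinates and then forgetting
  these coordinates preserves characteristicity: \<open>\<phi>\<close> acting on the remaining coordinates lifts
  to the automorphism \<open>id \<times> \<phi>\<close>, which fixes the event.\<close>

definition conditioned :: "torus set measure \<Rightarrow> torus set set \<Rightarrow> nat \<Rightarrow> torus set measure"
  where "conditioned \<mu> C n =
    distr (uniform_measure \<mu> C) (borel_of_top chabauty) ((`) (coords (\<lambda>i. i + n)))"

lemma
  assumes \<mu>: "\<mu> \<in> CRS" and C: "C \<in> sets (borel_of_top chabauty)" and pos: "measure \<mu> C \<noteq> 0"
  shows measure_conditioned: "A \<in> sets (borel_of_top chabauty) \<Longrightarrow> measure (conditioned \<mu> C n) A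
      = measure \<mu> (C \<inter> ((`) (coords (\<lambda>i. i + n)) -` A \<inter> closed_subgroups)) / measure \<mu> C"
    and conditioned_prob: "conditioned \<mu> C n \<in> borel_probs chabauty"
proof -
  note bp = borel_probs_chabautyD[OF CRS_prob[OF \<mu>]]
  interpret prob_space \<mu> by (rule bp)
  let ?U = "uniform_measure \<mu> C" and ?s = "(`) (coords (\<lambda>i. i + n))"
  have e: "emeasure \<mu> C \<noteq> 0" "emeasure \<mu> C \<noteq> \<infinity>"
    using pos by (auto simp: emeasure_eq_measure)
  have sU: "sets ?U = sets (borel_of_top chabauty)" by (simp add: bp)
  have spU: "space ?U = closed_subgroups" by (simp add: bp)
  have meas: "?s \<in> ?U \<rightarrow>\<^sub>M borel_of_top chabauty"
    using measurable_coords measurable_cong_sets[OF sU refl] by blast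
  interpret U: prob_space ?U using e by (rule prob_space_uniform_measure)
  have "prob_space (conditioned \<mu> C n)"
    unfolding conditioned_def using meas by (rule U.prob_space_distr)
  then show "conditioned \<mu> C n \<in> borel_probs chabauty"
    by (simp add: borel_probs_def conditioned_def)
  assume A: "A \<in> sets (borel_of_top chabauty)"
  have "?s -` A \<inter> closed_subgroups \<in> sets \<mu>"
    using measurable_sets[OF measurable_coords A] by (simp add: bp)
  then show "measure (conditioned \<mu> C n) A = measure \<mu> (C \<inter> (?s -` A \<inter> closed_subgroups)) / measure \<mu> C"
    unfolding conditioned_def
    by (simp only: measure_distr[OF meas A] spU measure_uniform_measure[OF e])
qed

lemma conditioned_CRS:
  assumes \<mu>: "\<mu> \<in> CRS" and C: "C \<in> sets (borel_of_top chabauty)" and pos: "measure \<mu> C \<noteq> 0"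
    and inv: "\<And>\<phi> H. \<phi> \<in> Aut \<Longrightarrow> H \<in> closed_subgroups \<Longrightarrow> extend_id n \<phi> ` H \<in> C \<longleftrightarrow> H \<in> C"
  shows "conditioned \<mu> C n \<in> CRS"
proof -
  let ?\<nu> = "conditioned \<mu> C n" and ?s = "(`) (coords (\<lambda>i. i + n))"
  note m = measure_conditioned[OF \<mu> C pos, of _ n] and prob = conditioned_prob[OF \<mu> C pos, of n]
  interpret N: prob_space ?\<nu> using prob by (rule borel_probs_chabautyD)
  have sN: "sets ?\<nu> = sets (borel_of_top chabauty)" "space ?\<nu> = closed_subgroups"
    using borel_probs_chabautyD[OF prob] by simp_all
  have "distr ?\<nu> (borel_of_top chabauty) ((`) \<phi>) = ?\<nu>" if \<phi>: "\<phi> \<in> Aut" for \<phi>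
  proof (rule measure_eqI)
    show "sets (distr ?\<nu> (borel_of_top chabauty) ((`) \<phi>)) = sets ?\<nu>" by (simp add: sN)
    fix A assume "A \<in> sets (distr ?\<nu> (borel_of_top chabauty) ((`) \<phi>))"
    then have A: "A \<in> sets (borel_of_top chabauty)" by simp
    have meas: "(`) \<phi> \<in> ?\<nu> \<rightarrow>\<^sub>M borel_of_top chabauty"
      using measurable_Aut_image[OF \<phi>] measurable_cong_sets[OF sN(1) refl] by blast
    have A': "(`) \<phi> -` A \<inter> closed_subgroups \<in> sets (borel_of_top chabauty)"
      using measurable_sets[OF meas A] by (simp add: sN)
    have D: "C \<inter> (?s -` A \<inter> closed_subgroups) \<in> sets (borel_of_top chabauty)"
      using measurable_sets[OF measurable_coords A] C by simp
    have sub: "C \<subseteq> closed_subgroups" using sets.sets_into_space[OF C] by simp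
    \<comment> \<open>Forgetting the first \<open>n\<close> coordinates intertwines the lifted
      automorphism with \<open>\<phi>\<close>, so invariance of \<open>\<mu>\<close> under the lift
      passes to invariance of the conditioned measure under \<open>\<phi>\<close>.\<close>
    have "?s (extend_id n \<phi> ` H) = \<phi> ` ?s H" for H
      by (auto simp: image_image coords_extend_id)
    then have "(`) (extend_id n \<phi>) -` (C \<inter> (?s -` A \<inter> closed_subgroups)) \<inter> closed_subgroups
      = C \<inter> (?s -` ((`) \<phi> -` A \<inter> closed_subgroups) \<inter> closed_subgroups)"
      using inv[OF \<phi>] Aut_image_closed_subgroups[OF extend_id_Aut[OF \<phi>]] coords_closed_subgroups sub
      by (auto 0 3)
    then have "measure \<mu> (C \<inter> (?s -` ((`) \<phi> -` A \<inter> closed_subgroups) \<inter> closed_subgroups))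
      = measure \<mu> (C \<inter> (?s -` A \<inter> closed_subgroups))"
      using CRS_emeasure_vimage[OF \<mu> extend_id_Aut[OF \<phi>, of n] D] by (simp only: measure_def)
    then have "measure ?\<nu> ((`) \<phi> -` A \<inter> closed_subgroups) = measure ?\<nu> A"
      by (simp only: m A A')
    then show "emeasure (distr ?\<nu> (borel_of_top chabauty) ((`) \<phi>)) A = emeasure ?\<nu> A"
      by (simp add: emeasure_distr[OF meas A] sN N.emeasure_eq_measure)
  qed
  then show ?thesis using prob by (simp add: CRS_def)
qed

text \<open>Because of this, conditioning on an event and on its complement and then forgetting
  coordinates decomposes \<open>\<mu>\<close> itself, not just some image of it.\<close>

lemma CRS_distr_shift:
  assumes \<mu>: "\<mu> \<in> CRS"
  shows "distr \<mu> (borel_of_top chabauty) ((`) (coords (\<lambda>i. i + n))) = \<mu>"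
proof (rule borel_probs_eqI)
  note bp = borel_probs_chabautyD[OF CRS_prob[OF \<mu>]]
  interpret prob_space \<mu> by (rule bp)
  have meas: "(`) (coords (\<lambda>i. i + n)) \<in> \<mu> \<rightarrow>\<^sub>M borel_of_top chabauty"
    using measurable_coords measurable_cong_sets[OF bp(2) refl] by blast
  show "distr \<mu> (borel_of_top chabauty) ((`) (coords (\<lambda>i. i + n))) \<in> borel_probs chabauty"
    using prob_space_distr[OF meas] by (simp add: borel_probs_def)
  show "measure (distr \<mu> (borel_of_top chabauty) ((`) (coords (\<lambda>i. i + n)))) (cyl F) = measure \<mu> (cyl F)" for F
    by (simp only: measure_distr[OF meas cyl_sets] bp coords_vimage_cyl CRS_shift[OF \<mu>])
qed (rule CRS_prob[OF \<mu>])

section \<open>Extremality versus independence\<close>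

lemma extreme_imp_multiplicative:
  assumes "\<mu> \<in> CRS_extreme"
  shows "multiplicative \<mu>"
  unfolding multiplicative_def
proof (intro allI impI)
  fix F G and n :: nat
  assume G: "support G \<subseteq> {..<n}"
  have \<mu>: "\<mu> \<in> CRS" using assms by (simp add: CRS_extreme_def extreme_measures_def)
  note bp = borel_probs_chabautyD[OF CRS_prob[OF \<mu>]]
  interpret prob_space \<mu> by (rule bp)
  let ?s = "(`) (coords (\<lambda>i. i + n))" and ?sF = "reindex (\<lambda>i. i + n) F"
  define C C' where "C = cyl G" and "C' = closed_subgroups - cyl G"
  have [simp]: "C \<in> sets (borel_of_top chabauty)" "C' \<in> sets (borel_of_top chabauty)"
    using sets.compl_sets[of "cyl G" "borel_of_top chabauty"] by (simp_all add: C_def C'_def)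
  \<comment> \<open>The complement gets the weight \<open>t\<close>, matching the order of the
    weights in \<open>extreme_measures\<close>.\<close>
  define t where "t = prob C'"
  have t: "prob C = 1 - t"
    using prob_compl[of C] by (simp add: t_def C_def C'_def bp)
  \<comment> \<open>Conditioning needs positive probability for \<open>C\<close> and for its
    complement, so trivial events are treated apart.\<close>
  consider "prob C = 0" | "prob C = 1" | "0 < t" "t < 1"
    using t prob_le_1[of C] measure_nonneg[of \<mu> C] by fastforce
  then have "prob (C \<inter> cyl ?sF) = prob (cyl F) * prob C"
  proof cases
    case 1
    then show ?thesis
      using finite_measure_mono[of "C \<inter> cyl ?sF" C] measure_nonneg[of \<mu> "C \<inter> cyl ?sF"]
      by (simp add: bp)
  next
    case 2
    then have "AE H in \<mu>. H \<in> C" using prob_eq_1[of C] by (simp add: bp)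
    then have "prob (C \<inter> cyl ?sF) = prob (cyl ?sF)"
      by (intro finite_measure_eq_AE) (auto simp: bp)
    then show ?thesis using 2 CRS_shift[OF \<mu>, of n F] by simp
  next
    case 3
    have inv: "extend_id n \<phi> ` H \<in> C \<longleftrightarrow> H \<in> C" "extend_id n \<phi> ` H \<in> C' \<longleftrightarrow> H \<in> C'"
      if "\<phi> \<in> Aut" "H \<in> closed_subgroups" for \<phi> H
      using that extend_id_image_cyl[OF that(1) G that(2)]
        Aut_image_closed_subgroups[OF extend_id_Aut[OF that(1)] that(2)]
      by (simp_all add: C_def C'_def)
    have nz: "prob C \<noteq> 0" "prob C' \<noteq> 0" using 3 t by (simp_all add: t_def)
    have CRS: "conditioned \<mu> C n \<in> CRS" "conditioned \<mu> C' n \<in> CRS"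
      using nz inv by (intro conditioned_CRS \<mu>; simp)+
    have "measure \<mu> A = (1 - t) * measure (conditioned \<mu> C n) A + t * measure (conditioned \<mu> C' n) A"
      if "A \<in> sets \<mu>" for A
    proof -
      have A: "A \<in> sets (borel_of_top chabauty)" using that by (simp add: bp)
      have sA: "?s -` A \<inter> closed_subgroups \<in> sets \<mu>"
        using measurable_sets[OF measurable_coords A] by (simp add: bp)
      have meas: "?s \<in> \<mu> \<rightarrow>\<^sub>M borel_of_top chabauty"
        using measurable_coords measurable_cong_sets[OF bp(2) refl] by blast
      have "measure \<mu> A = prob (?s -` A \<inter> closed_subgroups)"
        using measure_distr[OF meas A] by (simp add: CRS_distr_shift[OF \<mu>] bp)
      also have "?s -` A \<inter> closed_subgroups
        = (C \<inter> (?s -` A \<inter> closed_subgroups)) \<union> (C' \<inter> (?s -` A \<inter> closed_subgroups))"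
        by (auto simp: C_def C'_def)
      also have "prob \<dots> = prob (C \<inter> (?s -` A \<inter> closed_subgroups)) + prob (C' \<inter> (?s -` A \<inter> closed_subgroups))"
      proof (rule finite_measure_Union)
        show "C \<inter> (?s -` A \<inter> closed_subgroups) \<in> sets \<mu>" "C' \<inter> (?s -` A \<inter> closed_subgroups) \<in> sets \<mu>"
          using sA by (intro sets.Int[OF _ sA]; simp add: bp)+
      qed (auto simp: C_def C'_def)
      finally show ?thesis
        using nz by (simp add: measure_conditioned[OF \<mu> _ _ A] t[symmetric]) (simp add: t_def)
    qed
    \<comment> \<open>Extremality excludes distinct pieces. Equal pieces both coincide with
      \<open>\<mu>\<close>, so conditioning on \<open>C\<close> leaves the law of the later
      coordinates unchanged, which is independence.\<close>
    then have "conditioned \<mu> C n = conditioned \<mu> C' n"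
      using assms CRS 3 unfolding CRS_extreme_def extreme_measures_def by blast
    then have "measure \<mu> A = measure (conditioned \<mu> C n) A" if "A \<in> sets \<mu>" for A
      using \<open>\<And>A. A \<in> sets \<mu> \<Longrightarrow> measure \<mu> A = _ A\<close>[OF that] by (simp add: algebra_simps)
    then have "prob (cyl F) = measure (conditioned \<mu> C n) (cyl F)" by (simp add: bp)
    also have "\<dots> = prob (C \<inter> cyl ?sF) / prob C"
      using nz by (simp add: measure_conditioned[OF \<mu>] coords_vimage_cyl)
    finally show ?thesis using nz by (simp add: field_simps)
  qed
  then show "prob (cyl (?sF @ G)) = prob (cyl F) * prob (cyl G)"
    by (simp add: cyl_append C_def Int_commute)
qed

text \<open>The number of events that occur has nonnegative variance.\<close>

lemma (in prob_space) sum_prob_square_le: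
  fixes N :: nat
  assumes "\<And>k. A k \<in> events"
  shows "(\<Sum>k<N. prob (A k))\<^sup>2 \<le> (\<Sum>j<N. \<Sum>k<N. prob (A j \<inter> A k))"
proof -
  define X where "X x = (\<Sum>k<N. indicat_real (A k) x)" for x
  have X2: "(X x)\<^sup>2 = (\<Sum>j<N. \<Sum>k<N. indicat_real (A j \<inter> A k) x)" for x
    by (simp only: X_def power2_eq_square sum_product indicator_inter_arith)
  have int: "integrable M (indicat_real B)" if "B \<in> events" for B
    using that by (simp add: emeasure_eq_measure)
  have "expectation X = (\<Sum>k<N. prob (A k))"
    unfolding X_def by (subst Bochner_Integration.integral_sum) (simp_all add: int assms sets.Int_space_eq2)
  moreover have "expectation (\<lambda>x. (X x)\<^sup>2) = (\<Sum>j<N. \<Sum>k<N. prob (A j \<inter> A k))"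
    unfolding X2
    by (subst Bochner_Integration.integral_sum, (intro Bochner_Integration.integrable_sum int sets.Int assms),
        subst Bochner_Integration.integral_sum, (intro int sets.Int assms))
      (simp add: assms sets.Int sets.Int_space_eq2)
  moreover have "integrable M X" "integrable M (\<lambda>x. (X x)\<^sup>2)"
    unfolding X2 unfolding X_def by (intro Bochner_Integration.integrable_sum int sets.Int assms)+
  ultimately show ?thesis
    using variance_positive[of X] variance_eq[of X] by (metis diff_ge_0_iff_ge)
qed

text \<open>Disjoint shifts of a cylinder event are independent and identically distributed under \<open>\<mu>\<close>,
  so the number of those that occur among the first \<open>N\<close> has variance at most \<open>N\<close>. If \<open>\<mu>\<close> were
  a mixture of measures giving the event different probabilities, this variance would be at
  least of order \<open>N\<^sup>2\<close>.\<close>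

lemma multiplicative_imp_extreme:
  assumes \<mu>: "\<mu> \<in> CRS" and mult: "multiplicative \<mu>"
  shows "\<mu> \<in> CRS_extreme"
proof -
  have "\<nu> = \<nu>'" if \<nu>: "\<nu> \<in> CRS" and \<nu>': "\<nu>' \<in> CRS" and t: "0 < t" "t < 1"
    and eq: "\<forall>A\<in>sets \<mu>. measure \<mu> A = (1 - t) * measure \<nu> A + t * measure \<nu>' A" for \<nu> \<nu>' t
  proof (rule borel_probs_eqI)
    note bp = borel_probs_chabautyD[OF CRS_prob]
    fix F
    obtain m where m: "support F \<subseteq> {..<m}"
      using finite_support finite_nat_iff_bounded by blast
    \<comment> \<open>Shifting by multiples of \<open>m\<close> moves the support into disjoint
      blocks.\<close>
    define A where "A k = cyl (reindex (\<lambda>i. i + k * m) F)" for k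
    define c d d' where "c = measure \<mu> (cyl F)" and "d = measure \<nu> (cyl F)" and "d' = measure \<nu>' (cyl F)"
    have [simp]: "cyl G \<in> sets \<mu>" for G by (simp add: bp[OF \<mu>])
    have A_sets: "A k \<in> sets \<rho>" if "\<rho> \<in> CRS" for \<rho> k
      unfolding A_def by (simp add: bp[OF that])
    have c: "c = (1 - t) * d + t * d'" using eq by (simp add: c_def d_def d'_def)
    have c01: "0 \<le> c" "c \<le> 1"
      using prob_space.prob_le_1[OF bp(1)[OF \<mu>]] by (simp_all add: c_def)
    have indep: "measure \<mu> (A j \<inter> A k) = c * c" if "k < j" for j k
    proof -
      have "(k + 1) * m \<le> j * m" using that by (intro mult_right_mono) auto
      then have "support (reindex (\<lambda>i. i + k * m) F) \<subseteq> {..<j * m}"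
        using m by (force simp: support_reindex)
      then have "measure \<mu> (A j \<inter> A k) = measure \<mu> (cyl F) * measure \<mu> (A k)"
        using mult unfolding multiplicative_def A_def cyl_append[symmetric] by blast
      then show ?thesis by (simp add: A_def CRS_shift[OF \<mu>] c_def)
    qed
    have \<mu>2: "(\<Sum>j<N. \<Sum>k<N. measure \<mu> (A j \<inter> A k)) \<le> N + (N * c)\<^sup>2" for N :: nat
    proof -
      \<comment> \<open>Off the diagonal independence gives \<open>c * c\<close>; on the diagonal
        the trivial bound 1 suffices, as it costs only \<open>N\<close> in total.\<close>
      have "measure \<mu> (A j \<inter> A k) \<le> (if k = j then 1 else 0) + c * c" for j k
        using indep[of k j] indep[of j k] c01 prob_space.prob_le_1[OF bp(1)[OF \<mu>], of "A j"]
        by (cases j k rule: linorder_cases) (auto simp: Int_commute add_increasing2)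
      then have "(\<Sum>j<N. \<Sum>k<N. measure \<mu> (A j \<inter> A k))
          \<le> (\<Sum>j<N. \<Sum>k<N. (if k = j then 1 else 0) + c * c)"
        by (intro sum_mono)
      also have "\<dots> = N + (N * c)\<^sup>2"
        by (simp add: sum.distrib power2_eq_square algebra_simps)
      finally show ?thesis .
    qed
    have lower: "(N * measure \<rho> (cyl F))\<^sup>2 \<le> (\<Sum>j<N. \<Sum>k<N. measure \<rho> (A j \<inter> A k))"
      if \<rho>: "\<rho> \<in> CRS" for \<rho> and N :: nat
    proof -
      have "measure \<rho> (A k) = measure \<rho> (cyl F)" for k by (simp add: A_def CRS_shift[OF \<rho>])
      then show ?thesis
        using prob_space.sum_prob_square_le[OF bp(1)[OF \<rho>], of A N] A_sets[OF \<rho>] by simp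
    qed
    have bound: "N * (t * (1 - t) * (d - d')\<^sup>2) \<le> 1" if "N > 0" for N :: nat
    proof -
      have "(1 - t) * (N * d)\<^sup>2 + t * (N * d')\<^sup>2
        \<le> (1 - t) * (\<Sum>j<N. \<Sum>k<N. measure \<nu> (A j \<inter> A k)) + t * (\<Sum>j<N. \<Sum>k<N. measure \<nu>' (A j \<inter> A k))"
        using lower[OF \<nu>] lower[OF \<nu>'] t unfolding d_def d'_def
        by (intro add_mono mult_left_mono) auto
      also have "\<dots> = (\<Sum>j<N. \<Sum>k<N. measure \<mu> (A j \<inter> A k))"
        using eq A_sets[OF \<mu>] by (simp add: sum.distrib sum_distrib_left)
      also note \<mu>2
      finally have "(1 - t) * (N * d)\<^sup>2 + t * (N * d')\<^sup>2 - (N * c)\<^sup>2 \<le> N" by simp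
      \<comment> \<open>Up to the factor N squared this is the variance of a variable with value
        \<open>d\<close> with probability \<open>1 - t\<close> and \<open>d'\<close> with
        probability \<open>t\<close>, whose mean is \<open>c\<close>.\<close>
      also have "(1 - t) * (N * d)\<^sup>2 + t * (N * d')\<^sup>2 - (N * c)\<^sup>2 = N * (N * (t * (1 - t) * (d - d')\<^sup>2))"
        unfolding c by (simp add: power2_eq_square algebra_simps)
      finally show ?thesis using that by simp
    qed
    show "d = d'"
    proof (rule ccontr)
      assume "d \<noteq> d'"
      then have pos: "0 < t * (1 - t) * (d - d')\<^sup>2" using t by simp
      obtain N :: nat where N: "1 < N * (t * (1 - t) * (d - d')\<^sup>2)"
        using reals_Archimedean3[OF pos] by blast
      then have "N > 0" by (cases N) auto
      then show False using bound N by (meson not_le)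
    qed
  qed (rule CRS_prob[OF \<nu>] CRS_prob[OF \<nu>'])+
  then show ?thesis
    using \<mu> unfolding CRS_extreme_def extreme_measures_def by blast
qed

section \<open>Closedness in the weak* topology\<close>

lemma continuous_map_measure_cyl:
  "continuous_map CRS_topology euclideanreal (\<lambda>\<mu>. measure \<mu> (cyl F))"
proof -
  \<comment> \<open>The indicator of a clopen set is continuous, hence a test function of the weak*
    topology; its preimages depend only on which of 0 and 1 lie in \<open>U\<close>.\<close>
  have ind: "continuous_map chabauty euclideanreal (indicat_real (cyl F))"
    unfolding continuous_map_def
  proof (intro conjI allI impI)
    fix U :: "real set"
    consider "{H \<in> topspace chabauty. indicat_real (cyl F) H \<in> U} = {}"
      | "{H \<in> topspace chabauty. indicat_real (cyl F) H \<in> U} = cyl F"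
      | "{H \<in> topspace chabauty. indicat_real (cyl F) H \<in> U} = closed_subgroups - cyl F"
      | "{H \<in> topspace chabauty. indicat_real (cyl F) H \<in> U} = closed_subgroups"
    proof (cases "0 \<in> U"; cases "1 \<in> U")
      assume "0 \<in> U" "1 \<in> U"
      then have "{H \<in> topspace chabauty. indicat_real (cyl F) H \<in> U} = closed_subgroups"
        by (auto simp: indicator_def)
      then show thesis by (rule that(4))
    next
      assume "0 \<in> U" "1 \<notin> U"
      then have "{H \<in> topspace chabauty. indicat_real (cyl F) H \<in> U} = closed_subgroups - cyl F"
        by (auto simp: indicator_def)
      then show thesis by (rule that(3))
    next
      assume "0 \<notin> U" "1 \<in> U"
      then have "{H \<in> topspace chabauty. indicat_real (cyl F) H \<in> U} = cyl F"
        using cyl_subset[of F] by (auto simp: indicator_def)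
      then show thesis by (rule that(2))
    next
      assume "0 \<notin> U" "1 \<notin> U"
      then have "{H \<in> topspace chabauty. indicat_real (cyl F) H \<in> U} = {}"
        by (auto simp: indicator_def)
      then show thesis by (rule that(1))
    qed
    then show "openin chabauty {H \<in> topspace chabauty. indicat_real (cyl F) H \<in> U}"
      using openin_cyl[of F] openin_compl_cyl[of F] openin_cyl[of "[]"]
      by cases (simp_all only: cyl_Nil openin_empty)
  qed simp
  have "continuous_map (weak_star chabauty) euclideanreal (\<lambda>\<mu>. measure \<mu> (cyl F))"
    unfolding continuous_map_def
  proof (intro conjI allI impI)
    fix U :: "real set" assume "openin euclideanreal U"
    then have "open U" by simp
    have "(\<integral>x. indicat_real (cyl F) x \<partial>\<mu>) = measure \<mu> (cyl F)" if "\<mu> \<in> borel_probs chabauty" for \<mu>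
    proof -
      interpret prob_space \<mu> using that by (rule borel_probs_chabautyD)
      show ?thesis using borel_probs_chabautyD[OF that] cyl_subset[of F] by (simp add: Int_absorb2)
    qed
    then have "{\<mu> \<in> topspace (weak_star chabauty). measure \<mu> (cyl F) \<in> U}
      = {\<mu> \<in> borel_probs chabauty. (\<integral>x. indicat_real (cyl F) x \<partial>\<mu>) \<in> U}"
      by auto
    moreover have "openin (weak_star chabauty) \<dots>"
      unfolding weak_star_def using ind \<open>open U\<close> by (intro topology_generated_by_Basis) blast
    ultimately show "openin (weak_star chabauty) {\<mu> \<in> topspace (weak_star chabauty). measure \<mu> (cyl F) \<in> U}"
      by simp
  qed simp
  then show ?thesis
    unfolding CRS_topology_def by (rule continuous_map_from_subtopology)
qed

theorem corollary5p5:
  shows "closedin CRS_topology (CRS_extreme :: torus set measure set)"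
proof -
  have top: "topspace CRS_topology = (CRS :: torus set measure set)"
    using CRS_prob by (auto simp: CRS_topology_def)
  let ?E = "\<lambda>(F, G, n). {\<mu> \<in> topspace CRS_topology.
    measure \<mu> (cyl (reindex (\<lambda>i. i + n) F @ G)) = measure \<mu> (cyl F) * measure \<mu> (cyl G)}"
  have "CRS_extreme = {\<mu> \<in> CRS. multiplicative \<mu>}"
  proof (intro equalityI subsetI)
    fix \<mu> :: "torus set measure" assume "\<mu> \<in> CRS_extreme"
    then show "\<mu> \<in> {\<mu> \<in> CRS. multiplicative \<mu>}"
      using extreme_imp_multiplicative[of \<mu>] by (simp add: CRS_extreme_def extreme_measures_def)
  qed (simp add: multiplicative_imp_extreme)
  also have "\<dots> = CRS \<inter> (\<Inter>p\<in>{(F, G, n). support G \<subseteq> {..<n}}. ?E p)"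
    by (auto simp: multiplicative_def top)
  also have "\<dots> = (\<Inter>p\<in>{(F, G, n). support G \<subseteq> {..<n}}. ?E p)"
  proof -
    \<comment> \<open>A nonempty index set makes the intersection lie inside \<open>CRS\<close>,
      since each \<open>?E p\<close> does.\<close>
    have "([], [], 0) \<in> {(F, G, n). support G \<subseteq> {..<n}}" by (simp add: support_def)
    then show ?thesis using top by fastforce
  qed
  also have "closedin CRS_topology \<dots>"
  proof (rule closedin_INT)
    show "{(F, G, n). support G \<subseteq> {..<n}} \<noteq> ({} :: ((bool \<times> nat) list list \<times> (bool \<times> nat) list list \<times> nat) set)"
      by (auto simp: support_def intro!: exI[of _ "[]"])
    fix p :: "(bool \<times> nat) list list \<times> (bool \<times> nat) list list \<times> nat"
    show "closedin CRS_topology (?E p)"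
      unfolding case_prod_beta
      by (intro closedin_continuous_maps_eq[of euclideanreal] continuous_map_real_mult
          continuous_map_measure_cyl) simp
  qed
  finally show ?thesis .
qed

end
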